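(* Let $\Sigma$ be a finite alphabet, $w$ a positive integer, $\tau=(R_1,\dots,R_m)$ a relational vocabulary, and $\varphi(x_1,\dots,x_n)$ a first-order formula over $\tau$ whose free variables are among $x_1,\dots,x_n$. Then the relation $$\mathcal{R}(\Sigma,w,\tau,\varphi(x_1,\dots,x_n))=\{(D_0,D_1,\dots,D_m,v_1,\dots,v_n):(D_0,\dots,D_m)\in\mathcal{R}(\Sigma,w,\tau),\ v_1,\dots,v_n\in L(D_0),\ \mathcal{S}(D_0,\dots,D_m)\models\varphi[v_1,\dots,v_n]\}$$ is regular.
   Context: Padding and tensor products. Fix a padding symbol $\#$ not in any alphabet considered. For alphabets $\Gamma_1,\dots,\Gamma_a$, $\Gamma_1\otimes\cdots\otimes\Gamma_a$ is the Cartesian product regarded as an alphabet, and $\Gamma^{\otimes a}$ its $a$-fold power. For nonempty strings $u_i$ over $\Gamma_i$ of lengths $n_i$, $u_1\otimes\cdots\otimes u_a$ is the string of length $\max_i n_i$ whose $j$-th symbol is the tuple of $j$-th symbols of the $u_i$, with $\#$ in place of missing symbols. For languages, $L_1\otimes\cdots\otimes L_a=\{u_1\otimes\cdots\otimes u_a:u_i\in L_i\}$ and $L^{\otimes a}$ is the $a$-fold product. For a language $L$ over a tensor alphabet, $\mathcal{R}(L)=\{(u_1,\dots,u_a):u_1\otimes\cdots\otimes u_a\in L\}$. A relation $R\subseteq\Gamma_1^+\times\cdots\times\Gamma_a^+$ is regular if $\{u_1\otimes\cdots\otimes u_a:(u_1,\dots,u_a)\in R\}$ is accepted by a finite automaton.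 ODDs. For an alphabet $\Sigma$ and $w\ge1$, a $(\Sigma,w)$-layer is a tuple $B=(\ell,r,T,I,F,\iota,\phi)$ with $\ell,r\subseteq\{0,\dots,w-1\}$, $T\subseteq\ell\times(\Sigma\sqcup\{\#\})\times r$, $I\subseteq\ell$, $F\subseteq r$, $\iota,\phi$ Booleans, $I=\emptyset$ if $\iota$ is false and $F=\emptyset$ if $\phi$ is false. $\mathcal{B}(\Sigma,w)$ is the finite set of such layers, an alphabet. A $(\Sigma,w)$-ODD of length $k$ is a string $B_1\cdots B_k$ over $\mathcal{B}(\Sigma,w)$ with $\ell(B_{i+1})=r(B_i)$, $\iota(B_i)$ true iff $i=1$, $\phi(B_i)$ true iff $i=k$; $\mathcal{B}(\Sigma,w,k)$ is the set of them. A nonempty string $\sigma_1\cdots\sigma_{k'}$ over $\Sigma$, $k'\le k$, is accepted if, padding it with $\#$ to length $k$ (symbols $\hat\sigma_i$), there are $(p_i,\hat\sigma_i,q_i)\in T(B_i)$ with $p_{i+1}=q_i$, $p_1\in I(B_1)$, $q_k\in F(B_k)$; $L(D)$ is the set of accepted strings. Structural tuples. $\tau=(R_1,\dots,R_m)$ has arities $a_i$. A tuple $(D_0,\dots,D_m)$ is $(\Sigma,w,\tau)$-structural if for some $k\ge1$, $D_0\in\mathcal{B}(\Sigma,w,k)$, $D_i\in\mathcal{B}(\Sigma^{\otimes a_i},w,k)$ and $L(D_i)\subseteq L(D_0)^{\otimes a_i}$ for $i\in[m]$; its derived structure $\mathcal{S}(D_0,\dots,D_m)$ is the $\tau$-structure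 with domain $L(D_0)$ interpreting $R_i$ as $\mathcal{R}(L(D_i))$. $\mathcal{R}(\Sigma,w,\tau)$ is the set of all structural tuples. The relation in the claim has coordinates in $\mathcal{B}(\Sigma,w)^+$, $\mathcal{B}(\Sigma^{\otimes a_i},w)^+$ and $\Sigma^+$ respectively. *)

theory Defs
  imports Main
begin

text \<open>
  The padding symbol \<open>#\<close> is \<^term>\<open>None\<close>, so that \<open>\<Gamma> \<squnion> {#}\<close> is a set of options. Tuples are lists:
  \<^term>\<open>listset\<close> is the Cartesian product of a list of sets.
\<close>

definition with_pad :: "'g set \<Rightarrow> 'g option set" where
  "with_pad \<Gamma> = insert None (Some ` \<Gamma>)"

definition nonempty_strings :: "'g set \<Rightarrow> 'g list set" where
  "nonempty_strings \<Gamma> = lists \<Gamma> - {[]}"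

definition sym_at :: "'g list \<Rightarrow> nat \<Rightarrow> 'g option" where
  "sym_at u j = (if j < length u then Some (u ! j) else None)"

text \<open>
  Read literally, \<open>\<Gamma>\<^sub>1 \<otimes> \<dots> \<otimes> \<Gamma>\<^sub>a\<close> is the plain product, but the symbols of \<open>u\<^sub>1 \<otimes> \<dots> \<otimes> u\<^sub>a\<close> may have
  \<open>#\<close> in some of their coordinates. The flag selects between the product of the sets \<open>\<Gamma>\<^sub>i \<squnion> {#}\<close>
  (\<^term>\<open>True\<close>) and the product of the \<open>\<Gamma>\<^sub>i\<close> themselves (\<^term>\<open>False\<close>), which as an alphabet of
  decision diagrams only admits relations between strings of equal length. The two choices differ
  only in the alphabets \<open>\<Sigma>\<^sup>\<otimes>\<^sup>a\<close> of the diagrams; automata for relations always read padded tuples.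
\<close>

definition tensor_alphabet :: "bool \<Rightarrow> 'g set list \<Rightarrow> 'g option list set" where
  "tensor_alphabet padded \<Gamma>s =
     listset (map (\<lambda>\<Gamma>. if padded then with_pad \<Gamma> else Some ` \<Gamma>) \<Gamma>s)"

definition tensor :: "'g list list \<Rightarrow> 'g option list list" where
  "tensor us = map (\<lambda>j. map (\<lambda>u. sym_at u j) us) [0..<Max (length ` set us)]"

definition tensor_lang :: "'g list set list \<Rightarrow> 'g option list list set" where
  "tensor_lang Ls = tensor ` listset Ls"

definition rel_of_lang :: "nat \<Rightarrow> 'g option list list set \<Rightarrow> 'g list list set" where
  "rel_of_lang a L = {us. length us = a \<and> [] \<notin> set us \<and> tensor us \<in> L}"


record 's nfa =
  states :: "nat set"
  initial :: "nat set"
  accepting :: "nat set"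
  delta :: "(nat \<times> 's \<times> nat) set"

definition finite_automaton :: "'s set \<Rightarrow> 's nfa \<Rightarrow> bool" where
  "finite_automaton \<Gamma> \<A> \<longleftrightarrow>
     finite \<Gamma> \<and> finite (states \<A>) \<and> initial \<A> \<subseteq> states \<A> \<and> accepting \<A> \<subseteq> states \<A> \<and>
     delta \<A> \<subseteq> states \<A> \<times> \<Gamma> \<times> states \<A>"

definition nfa_lang :: "'s nfa \<Rightarrow> 's list set" where
  "nfa_lang \<A> = {x. \<exists>\<rho>. length \<rho> = Suc (length x) \<and> \<rho> ! 0 \<in> initial \<A> \<and>
     (\<forall>i<length x. (\<rho> ! i, x ! i, \<rho> ! Suc i) \<in> delta \<A>) \<and> \<rho> ! length x \<in> accepting \<A>}"

definition regular_relation :: "'g set list \<Rightarrow> 'g list list set \<Rightarrow> bool" where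
  "regular_relation \<Gamma>s R \<longleftrightarrow>
     R \<subseteq> listset (map nonempty_strings \<Gamma>s) \<and>
     (\<exists>\<A>. finite_automaton (tensor_alphabet True \<Gamma>s) \<A> \<and> nfa_lang \<A> = tensor ` R)"


record 's layer =
  lft :: "nat set"
  rgt :: "nat set"
  edges :: "(nat \<times> 's option \<times> nat) set"
  init :: "nat set"
  final :: "nat set"
  is_first :: bool
  is_last :: bool

definition layers :: "'s set \<Rightarrow> nat \<Rightarrow> 's layer set" where
  "layers \<Sigma> w = {B. lft B \<subseteq> {..<w} \<and> rgt B \<subseteq> {..<w} \<and>
     edges B \<subseteq> lft B \<times> with_pad \<Sigma> \<times> rgt B \<and> init B \<subseteq> lft B \<and> final B \<subseteq> rgt B \<and>
     (\<not> is_first B \<longrightarrow> init B = {}) \<and> (\<not> is_last B \<longrightarrow> final B = {})}"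

definition odds :: "'s set \<Rightarrow> nat \<Rightarrow> nat \<Rightarrow> 's layer list set" where
  "odds \<Sigma> w k = {D. length D = k \<and> set D \<subseteq> layers \<Sigma> w \<and>
     (\<forall>i. Suc i < k \<longrightarrow> lft (D ! Suc i) = rgt (D ! i)) \<and>
     (\<forall>i<k. (is_first (D ! i) \<longleftrightarrow> i = 0) \<and> (is_last (D ! i) \<longleftrightarrow> Suc i = k))}"

text \<open>
  The alphabet is not an argument: if the layers of \<open>D\<close> belong to \<^term>\<open>layers \<Sigma> w\<close>, then every
  accepted string is a string over \<open>\<Sigma>\<close>.
\<close>

definition odd_lang :: "'s layer list \<Rightarrow> 's list set" where
  "odd_lang D = {s. s \<noteq> [] \<and> length s \<le> length D \<and>
     (\<exists>p q. (\<forall>i<length D. (p i, sym_at s i, q i) \<in> edges (D ! i)) \<and>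
            (\<forall>i. Suc i < length D \<longrightarrow> p (Suc i) = q i) \<and>
            p 0 \<in> init (D ! 0) \<and> q (length D - 1) \<in> final (D ! (length D - 1)))}"


text \<open>
  A relational vocabulary \<open>(R\<^sub>1, \<dots>, R\<^sub>m)\<close> is the list of its arities; \<open>R\<^sub>i\<close> is referred to by the
  index \<open>i - 1\<close>, and likewise the variable \<open>x\<^sub>j\<close> by \<open>j - 1\<close>.
\<close>

datatype fo_formula =
    Eq nat nat
  | Rel nat "nat list"
  | Neg fo_formula
  | Conj fo_formula fo_formula
  | Disj fo_formula fo_formula
  | Exists nat fo_formula
  | Forall nat fo_formula

primrec formula_over :: "nat list \<Rightarrow> fo_formula \<Rightarrow> bool" where
  "formula_over \<tau> (Eq x y) \<longleftrightarrow> True"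
| "formula_over \<tau> (Rel i xs) \<longleftrightarrow> i < length \<tau> \<and> length xs = \<tau> ! i"
| "formula_over \<tau> (Neg \<phi>) \<longleftrightarrow> formula_over \<tau> \<phi>"
| "formula_over \<tau> (Conj \<phi> \<psi>) \<longleftrightarrow> formula_over \<tau> \<phi> \<and> formula_over \<tau> \<psi>"
| "formula_over \<tau> (Disj \<phi> \<psi>) \<longleftrightarrow> formula_over \<tau> \<phi> \<and> formula_over \<tau> \<psi>"
| "formula_over \<tau> (Exists x \<phi>) \<longleftrightarrow> formula_over \<tau> \<phi>"
| "formula_over \<tau> (Forall x \<phi>) \<longleftrightarrow> formula_over \<tau> \<phi>"

primrec free_vars :: "fo_formula \<Rightarrow> nat set" where
  "free_vars (Eq x y) = {x, y}"
| "free_vars (Rel i xs) = set xs"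
| "free_vars (Neg \<phi>) = free_vars \<phi>"
| "free_vars (Conj \<phi> \<psi>) = free_vars \<phi> \<union> free_vars \<psi>"
| "free_vars (Disj \<phi> \<psi>) = free_vars \<phi> \<union> free_vars \<psi>"
| "free_vars (Exists x \<phi>) = free_vars \<phi> - {x}"
| "free_vars (Forall x \<phi>) = free_vars \<phi> - {x}"

record 'd fo_structure =
  domain :: "'d set"
  interp :: "nat \<Rightarrow> 'd list set"

primrec sat :: "'d fo_structure \<Rightarrow> (nat \<Rightarrow> 'd) \<Rightarrow> fo_formula \<Rightarrow> bool" where
  "sat S e (Eq x y) \<longleftrightarrow> e x = e y"
| "sat S e (Rel i xs) \<longleftrightarrow> map e xs \<in> interp S i"
| "sat S e (Neg \<phi>) \<longleftrightarrow> \<not> sat S e \<phi>"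
| "sat S e (Conj \<phi> \<psi>) \<longleftrightarrow> sat S e \<phi> \<and> sat S e \<psi>"
| "sat S e (Disj \<phi> \<psi>) \<longleftrightarrow> sat S e \<phi> \<or> sat S e \<psi>"
| "sat S e (Exists x \<phi>) \<longleftrightarrow> (\<exists>d\<in>domain S. sat S (e(x := d)) \<phi>)"
| "sat S e (Forall x \<phi>) \<longleftrightarrow> (\<forall>d\<in>domain S. sat S (e(x := d)) \<phi>)"


definition structural_tuples ::
  "bool \<Rightarrow> 'a set \<Rightarrow> nat \<Rightarrow> nat list \<Rightarrow> ('a layer list \<times> 'a option list layer list list) set" where
  "structural_tuples padded \<Sigma> w \<tau> = {(D\<^sub>0, Ds). length Ds = length \<tau> \<and>
     (\<exists>k\<ge>1. D\<^sub>0 \<in> odds \<Sigma> w k \<and>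
       (\<forall>i<length \<tau>.
          Ds ! i \<in> odds (tensor_alphabet padded (replicate (\<tau> ! i) \<Sigma>)) w k \<and>
          odd_lang (Ds ! i) \<subseteq> tensor_lang (replicate (\<tau> ! i) (odd_lang D\<^sub>0))))}"

definition derived_structure ::
  "nat list \<Rightarrow> 'a layer list \<Rightarrow> 'a option list layer list list \<Rightarrow> 'a list fo_structure" where
  "derived_structure \<tau> D\<^sub>0 Ds =
     \<lparr>domain = odd_lang D\<^sub>0, interp = (\<lambda>i. rel_of_lang (\<tau> ! i) (odd_lang (Ds ! i)))\<rparr>"

text \<open>
  The coordinates of the relation are strings over different types of symbols; the constructors
  below embed them into one type.
\<close>

datatype 'a symbol =
    Dom_Layer "'a layer"
  | Rel_Layer "'a option list layer"
  | Letter 'a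

definition coord_alphabets :: "bool \<Rightarrow> 'a set \<Rightarrow> nat \<Rightarrow> nat list \<Rightarrow> nat \<Rightarrow> 'a symbol set list" where
  "coord_alphabets padded \<Sigma> w \<tau> n =
     Dom_Layer ` layers \<Sigma> w #
     map (\<lambda>a. Rel_Layer ` layers (tensor_alphabet padded (replicate a \<Sigma>)) w) \<tau> @
     replicate n (Letter ` \<Sigma>)"

definition sat_relation ::
  "bool \<Rightarrow> 'a set \<Rightarrow> nat \<Rightarrow> nat list \<Rightarrow> nat \<Rightarrow> fo_formula \<Rightarrow> 'a symbol list list set" where
  "sat_relation padded \<Sigma> w \<tau> n \<phi> =
     {map Dom_Layer D\<^sub>0 # map (map Rel_Layer) Ds @ map (map Letter) vs | D\<^sub>0 Ds vs.
        (D\<^sub>0, Ds) \<in> structural_tuples padded \<Sigma> w \<tau> \<and>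
        length vs = n \<and> set vs \<subseteq> odd_lang D\<^sub>0 \<and>
        sat (derived_structure \<tau> D\<^sub>0 Ds) (\<lambda>j. vs ! j) \<phi>}"

end

theory Submission
  imports Defs
begin

text \<open>
  Regularity is handled through the Myhill--Nerode criterion that a language has only finitely many
  left quotients. It makes sense over infinite alphabets, and closure under Boolean operations and
  under images and preimages of letter-to-letter maps is immediate, without automata. A diagram of
  length \<open>k\<close> accepts only strings of length at most \<open>k\<close>, so a tuple of diagrams together with any
  assignment of domain elements is a word of length exactly \<open>k\<close> whose letters are padded columns, and
  quantifying over the domain is erasing one row of such words: the padding never grows. The atomic
  conditions are either conditions on single columns or the existence of a run through states below
  \<open>w\<close> (or sets of such states). The inclusion \<open>L(D\<^sub>i) \<subseteq> L(D\<^sub>0)\<^sup>\<otimes>\<^sup>a\<close> is expressed in the same way, by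
  quantifying over an auxiliary row that holds a string over the tensor alphabet.
\<close>

section \<open>Regular languages by left quotients\<close>

definition left_quotient :: "'c list \<Rightarrow> 'c list set \<Rightarrow> 'c list set" where
  "left_quotient u L = {v. u @ v \<in> L}"

definition regular :: "'c list set \<Rightarrow> bool" where
  "regular L \<longleftrightarrow> finite (range (\<lambda>u. left_quotient u L))"

text \<open>An upper bound on the quotients suffices: the proofs below exhibit a finite set
  containing them without deciding which members occur.\<close>

lemma regularI:
  assumes "finite K" and "\<And>u. left_quotient u L \<in> K"
  shows "regular L"
  unfolding regular_def using assms by (meson finite_subset image_subsetI)

lemma regular_Compl: "regular L \<Longrightarrow> regular (- L)"
  by (rule regularI[of "uminus ` range (\<lambda>u. left_quotient u L)"])
    (auto simp: regular_def left_quotient_def)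

lemma regular_Int:
  assumes "regular L" and "regular M"
  shows "regular (L \<inter> M)"
proof (rule regularI)
  let ?K = "(\<lambda>(A, B). A \<inter> B) ` (range (\<lambda>u. left_quotient u L) \<times> range (\<lambda>u. left_quotient u M))"
  show "finite ?K"
    using assms by (auto simp: regular_def)
  fix u
  have "left_quotient u (L \<inter> M) = left_quotient u L \<inter> left_quotient u M"
    by (auto simp: left_quotient_def)
  then show "left_quotient u (L \<inter> M) \<in> ?K"
    by auto
qed

lemma regular_Inter_finite:
  assumes "finite T" and "\<And>t. t \<in> T \<Longrightarrow> regular (L t)"
  shows "regular (\<Inter>t\<in>T. L t)"
  using assms
proof (induction T rule: finite_induct)
  case empty
  show ?case
    by (rule regularI[of "{UNIV}"]) (auto simp: left_quotient_def)
qed (simp add: regular_Int)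

text \<open>Each quotient is the preimage of a quotient of \<open>L\<close>, namely the one by
  \<open>map f u\<close>.\<close>

lemma regular_map_vimage:
  assumes "regular L"
  shows "regular {x. map f x \<in> L}"
proof (rule regularI)
  let ?K = "(\<lambda>A. {v. map f v \<in> A}) ` range (\<lambda>u. left_quotient u L)"
  show "finite ?K"
    using assms by (simp add: regular_def)
  fix u
  have "left_quotient u {x. map f x \<in> L} = {v. map f v \<in> left_quotient (map f u) L}"
    by (auto simp: left_quotient_def)
  then show "left_quotient u {x. map f x \<in> L} \<in> ?K"
    by auto
qed

text \<open>A power-set construction: the quotient by \<open>u\<close> is the union of the images of
  the quotients of \<open>L\<close> by all \<open>u'\<close> with \<open>map f u' = u\<close>. These
  \<open>u'\<close> may be infinitely many, but their quotients form a subset of a finite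
  set.\<close>

lemma regular_map_image:
  assumes "regular L"
  shows "regular (map f ` L)"
proof (rule regularI)
  let ?K = "(\<lambda>C. \<Union>A\<in>C. map f ` A) ` Pow (range (\<lambda>u. left_quotient u L))"
  show "finite ?K"
    using assms by (simp add: regular_def)
  fix u
  have "left_quotient u (map f ` L) =
      (\<Union>A\<in>(\<lambda>u'. left_quotient u' L) ` {u'. map f u' = u}. map f ` A)"
  proof (intro equalityI subsetI)
    fix v
    assume "v \<in> left_quotient u (map f ` L)"
    then obtain x where x: "x \<in> L" "u @ v = map f x"
      by (auto simp: left_quotient_def)
    then obtain u' v' where "x = u' @ v'" "map f u' = u" "map f v' = v"
      by (auto simp: append_eq_map_conv)
    with x show "v \<in> (\<Union>A\<in>(\<lambda>u'. left_quotient u' L) ` {u'. map f u' = u}. map f ` A)"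
      by (auto simp: left_quotient_def)
  next
    fix v
    assume "v \<in> (\<Union>A\<in>(\<lambda>u'. left_quotient u' L) ` {u'. map f u' = u}. map f ` A)"
    then obtain u' v' where "map f u' = u" "v = map f v'" "u' @ v' \<in> L"
      by (auto simp: left_quotient_def)
    then have "u @ v = map f (u' @ v')"
      by simp
    with \<open>u' @ v' \<in> L\<close> show "v \<in> left_quotient u (map f ` L)"
      unfolding left_quotient_def by blast
  qed
  then show "left_quotient u (map f ` L) \<in> ?K"
    by (rule image_eqI) auto
qed

lemma regular_all_letters: "regular {x. \<forall>c\<in>set x. P c}"
proof (rule regularI)
  let ?A = "{x. \<forall>c\<in>set x. P c}"
  fix u
  have "left_quotient u ?A = (if u \<in> ?A then ?A else {})"
    by (auto simp: left_quotient_def)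
  then show "left_quotient u ?A \<in> {{}, ?A}"
    by simp
qed simp

text \<open>With \<open>P\<close> saying that a fixed row shows padding, this is the condition that
  padding, once begun, never ends. A prefix matters only through its validity and through whether
  \<open>P\<close> has occurred in it.\<close>

lemma regular_sorted_wrt:
  "regular {x. sorted_wrt (\<lambda>c c'. P c \<longrightarrow> P c') x}"
proof (rule regularI)
  let ?W = "{x. sorted_wrt (\<lambda>c c'. P c \<longrightarrow> P c') x}"
  fix u
  have "left_quotient u ?W =
    (if u \<notin> ?W then {} else if \<exists>c\<in>set u. P c then {v\<in>?W. \<forall>c\<in>set v. P c} else ?W)"
    by (auto simp: left_quotient_def sorted_wrt_append)
  then show "left_quotient u ?W \<in> {{}, ?W, {v\<in>?W. \<forall>c\<in>set v. P c}}"
    by simp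
qed simp

text \<open>
  The two Boolean arguments of the transition relation tell whether the letter is the first and
  whether it is the last one of the word.
\<close>

lemma regular_runs:
  fixes \<delta> :: "bool \<Rightarrow> bool \<Rightarrow> 'q \<Rightarrow> 'c \<Rightarrow> 'q \<Rightarrow> bool"
  assumes "finite Q"
  shows "regular {x. x \<noteq> [] \<and> (\<exists>\<rho>. (\<forall>i\<le>length x. \<rho> i \<in> Q) \<and>
    (\<forall>i<length x. \<delta> (i = 0) (Suc i = length x) (\<rho> i) (x ! i) (\<rho> (Suc i))))}"
    (is "regular ?L")
proof (rule regularI)
  \<comment> \<open>The states reachable by reading \<open>u\<close>. The last-letter flag is
    \<open>False\<close> because a nonempty continuation is to follow.\<close>
  define reach where "reach u = {\<rho> (length u) | \<rho>. (\<forall>i\<le>length u. \<rho> i \<in> Q) \<and>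
    (\<forall>i<length u. \<delta> (i = 0) False (\<rho> i) (u ! i) (\<rho> (Suc i)))}" for u
  \<comment> \<open>A quotient by a nonempty \<open>u\<close> is determined by the reachable set and
    one bit, membership of \<open>u\<close> itself. The bit is separate because accepting
    \<open>u\<close> means reading its last letter with the flag set.\<close>
  define G where "G S b = {v. if v = [] then b else \<exists>\<rho>. \<rho> 0 \<in> S \<and> (\<forall>i\<le>length v. \<rho> i \<in> Q) \<and>
    (\<forall>i<length v. \<delta> False (Suc i = length v) (\<rho> i) (v ! i) (\<rho> (Suc i)))}" for S b
  \<comment> \<open>\<open>?L\<close> covers the empty prefix, the only one after which the first
    letter is still to be read.\<close>
  let ?K = "insert ?L ((\<lambda>(S, b). G S b) ` (Pow Q \<times> UNIV))"
  show "finite ?K"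
    using assms by simp
  fix u
  show "left_quotient u ?L \<in> ?K"
  proof (cases "u = []")
    case True
    then show ?thesis
      by (simp add: left_quotient_def)
  next
    case False
    have "u @ v \<in> ?L \<longleftrightarrow> v \<in> G (reach u) (u \<in> ?L)" for v
    proof (cases "v = []")
      case True
      then show ?thesis
        by (simp add: G_def)
    next
      case v: False
      show ?thesis
      proof
        assume "u @ v \<in> ?L"
        then obtain \<rho> where \<rho>: "\<forall>i\<le>length u + length v. \<rho> i \<in> Q"
          "\<forall>i<length u + length v. \<delta> (i = 0) (Suc i = length u + length v) (\<rho> i) ((u @ v) ! i) (\<rho> (Suc i))"
          by auto
        have "\<delta> (i = 0) False (\<rho> i) (u ! i) (\<rho> (Suc i))" if "i < length u" for i
        proof -
          have "Suc i \<noteq> length u + length v" "i < length u + length v"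
            using that v by (cases v; simp)+
          then show ?thesis
            using \<rho>(2)[rule_format, of i] that by (simp add: nth_append)
        qed
        then have "\<rho> (length u) \<in> reach u"
          using \<rho>(1) unfolding reach_def by auto
        moreover have "\<delta> False (Suc i = length v) (\<rho> (length u + i)) (v ! i) (\<rho> (length u + Suc i))"
          if "i < length v" for i
          using \<rho>(2)[rule_format, of "length u + i"] that False by (auto simp: nth_append)
        ultimately have "\<exists>\<rho>. \<rho> 0 \<in> reach u \<and> (\<forall>i\<le>length v. \<rho> i \<in> Q) \<and>
          (\<forall>i<length v. \<delta> False (Suc i = length v) (\<rho> i) (v ! i) (\<rho> (Suc i)))"
          using \<rho>(1) by (intro exI[of _ "\<lambda>i. \<rho> (length u + i)"]) simp
        then show "v \<in> G (reach u) (u \<in> ?L)"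
          using v by (simp add: G_def)
      next
        assume "v \<in> G (reach u) (u \<in> ?L)"
        then obtain \<rho>1 \<rho>2 where \<rho>1: "\<forall>i\<le>length u. \<rho>1 i \<in> Q"
          "\<forall>i<length u. \<delta> (i = 0) False (\<rho>1 i) (u ! i) (\<rho>1 (Suc i))"
          and \<rho>2: "\<rho>2 0 = \<rho>1 (length u)" "\<forall>i\<le>length v. \<rho>2 i \<in> Q"
          "\<forall>i<length v. \<delta> False (Suc i = length v) (\<rho>2 i) (v ! i) (\<rho>2 (Suc i))"
          using v unfolding G_def reach_def by auto
        define \<rho> where "\<rho> i = (if i \<le> length u then \<rho>1 i else \<rho>2 (i - length u))" for i
        have "\<forall>i\<le>length (u @ v). \<rho> i \<in> Q"
          using \<rho>1 \<rho>2 by (auto simp: \<rho>_def)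
        moreover have "\<delta> (i = 0) (Suc i = length (u @ v)) (\<rho> i) ((u @ v) ! i) (\<rho> (Suc i))"
          if i: "i < length (u @ v)" for i
        proof (cases "i < length u")
          case True
          then have "Suc i = length (u @ v) \<longleftrightarrow> False"
            using v by (cases v) auto
          with True show ?thesis
            using \<rho>1(2)[rule_format, of i]
            by (simp add: \<rho>_def nth_append)
        next
          case i': False
          have "\<rho> i = \<rho>2 (i - length u)"
            using i' \<rho>2(1) by (auto simp: \<rho>_def)
          moreover have "\<rho> (Suc i) = \<rho>2 (Suc (i - length u))"
            using i' by (auto simp: \<rho>_def Suc_diff_le)
          moreover have "(Suc (i - length u) = length v) = (Suc i = length (u @ v))"
            using i' by auto
          moreover have "i \<noteq> 0"
            using i' False by (cases u) auto
          ultimately show ?thesis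
            using \<rho>2(3)[rule_format, of "i - length u"] i i' by (auto simp: nth_append)
        qed
        ultimately show "u @ v \<in> ?L"
          using v by (intro CollectI conjI exI[of _ \<rho>]) simp_all
      qed
    qed
    then have "left_quotient u ?L = G (reach u) (u \<in> ?L)"
      unfolding left_quotient_def by (intro set_eqI) (simp only: mem_Collect_eq)
    moreover have "reach u \<subseteq> Q"
      by (auto simp: reach_def)
    ultimately show ?thesis
      by (intro insertI2 image_eqI[of _ _ "(reach u, u \<in> ?L)"]) simp_all
  qed
qed

section \<open>The automaton of left quotients\<close>

text \<open>The Myhill-Nerode construction. Quotients are numbered because the states of an
  \<open>nfa\<close> are natural numbers.\<close>

lemma regular_imp_nfa:
  assumes L: "regular L" and \<Gamma>: "finite \<Gamma>" "L \<subseteq> lists \<Gamma>"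
  shows "\<exists>\<A>. finite_automaton \<Gamma> \<A> \<and> nfa_lang \<A> = L"
proof -
  let ?K = "range (\<lambda>u. left_quotient u L)"
  have fin: "finite ?K"
    using L by (simp add: regular_def)
  obtain code :: "'a list set \<Rightarrow> nat" and N where "code ` ?K = {i. i < N}" and inj: "inj_on code ?K"
    using finite_imp_inj_to_nat_seg[OF fin] by (elim exE conjE)
  \<comment> \<open>A state is named by any word leading to it; \<open>st_snoc\<close> and
    \<open>st_L\<close> show that transitions and acceptance do not depend on the word
    chosen.\<close>
  define st where "st u = code (left_quotient u L)" for u
  define \<A> where "\<A> = \<lparr>states = range st, initial = {st []}, accepting = st ` L,
    delta = {(st u, c, st (u @ [c])) | u c. c \<in> \<Gamma>}\<rparr>"
  have \<A>: "initial \<A> = {st []}" "accepting \<A> = st ` L" "states \<A> = range st"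
    "(q, c, q') \<in> delta \<A> \<longleftrightarrow> (\<exists>u. q = st u \<and> q' = st (u @ [c])) \<and> c \<in> \<Gamma>" for q c q'
    by (auto simp: \<A>_def)
  have st_eq: "st u = st u' \<longleftrightarrow> left_quotient u L = left_quotient u' L" for u u'
    unfolding st_def by (rule inj_on_eq_iff[OF inj]) simp_all
  have st_snoc: "st (u @ [c]) = st (u' @ [c])" if "st u = st u'" for u u' c
  proof -
    have "left_quotient (u @ [c]) L = {v. c # v \<in> left_quotient u L}" for u
      by (simp add: left_quotient_def)
    then show ?thesis
      using that unfolding st_eq by simp
  qed
  have st_L: "u \<in> L" if "st u = st u'" "u' \<in> L" for u u'
  proof -
    have "[] \<in> left_quotient u L"
      using that unfolding st_eq by (simp add: left_quotient_def)
    then show ?thesis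
      by (simp add: left_quotient_def)
  qed
  \<comment> \<open>By \<open>st_snoc\<close> the automaton is deterministic, so a run from
    \<open>st []\<close> passes through the codes of the prefixes of \<open>x\<close>.\<close>
  have run: "\<rho> ! i = st (take i x)"
    if "\<rho> ! 0 = st []" "\<forall>i<length x. (\<rho> ! i, x ! i, \<rho> ! Suc i) \<in> delta \<A>" "i \<le> length x" for \<rho> x i
    using that(3)
  proof (induction i)
    case 0
    then show ?case
      using that(1) by simp
  next
    case (Suc i)
    have "(\<rho> ! i, x ! i, \<rho> ! Suc i) \<in> delta \<A>"
      using that(2) Suc.prems by simp
    then obtain u where u: "\<rho> ! i = st u" "\<rho> ! Suc i = st (u @ [x ! i])"
      unfolding \<A> by blast
    have "st u = st (take i x)"
      using u(1) Suc by simp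
    then have "\<rho> ! Suc i = st (take i x @ [x ! i])"
      unfolding u(2) by (rule st_snoc)
    then show ?case
      using Suc.prems by (simp add: take_Suc_conv_app_nth)
  qed
  have "range st = code ` ?K"
    by (auto simp: st_def)
  then have "finite (range st)"
    using fin by simp
  then have "finite_automaton \<Gamma> \<A>"
    using \<Gamma> by (auto simp: finite_automaton_def \<A>)
  moreover have "nfa_lang \<A> = L"
  proof (intro equalityI subsetI)
    fix x
    assume "x \<in> nfa_lang \<A>"
    then obtain \<rho> where \<rho>: "\<rho> ! 0 = st []" "\<forall>i<length x. (\<rho> ! i, x ! i, \<rho> ! Suc i) \<in> delta \<A>"
      "\<rho> ! length x \<in> st ` L"
      unfolding nfa_lang_def mem_Collect_eq \<A>(1,2) by blast
    then obtain u where "st x = st u" "u \<in> L"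
      using run[OF \<rho>(1,2), of "length x"] by auto
    then show "x \<in> L"
      by (rule st_L)
  next
    fix x
    assume x: "x \<in> L"
    define \<rho> where "\<rho> = map (\<lambda>i. st (take i x)) [0..<Suc (length x)]"
    have \<rho>: "\<rho> ! i = st (take i x)" if "i \<le> length x" for i
      using that unfolding \<rho>_def by (simp del: upt_Suc)
    have "(\<rho> ! i, x ! i, \<rho> ! Suc i) \<in> delta \<A>" if i: "i < length x" for i
    proof -
      have "x ! i \<in> \<Gamma>"
        using x \<Gamma>(2) i by (auto simp: in_lists_conv_set)
      moreover have "\<rho> ! i = st (take i x)" "\<rho> ! Suc i = st (take i x @ [x ! i])"
        using i \<rho>[of i] \<rho>[of "Suc i"] by (simp_all add: take_Suc_conv_app_nth)
      ultimately show ?thesis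
        unfolding \<A> by blast
    qed
    moreover have "length \<rho> = Suc (length x)"
      by (simp add: \<rho>_def)
    moreover have "\<rho> ! 0 \<in> initial \<A>" "\<rho> ! length x \<in> accepting \<A>"
      using \<rho>[of 0] \<rho>[of "length x"] x by (simp_all add: \<A>)
    ultimately show "x \<in> nfa_lang \<A>"
      unfolding nfa_lang_def by (intro CollectI exI[of _ \<rho>]) simp
  qed
  ultimately show ?thesis
    by blast
qed

section \<open>Definable predicates on padded tuples of strings\<close>

lemma sym_at_map: "sym_at (map f u) p = map_option f (sym_at u p)"
  by (simp add: sym_at_def)

lemma sym_at_eq_None_iff: "sym_at u p = None \<longleftrightarrow> length u \<le> p"
  by (simp add: sym_at_def)

text \<open>If the lengths differ, then at the end of the shorter string, which lies below
  \<open>k\<close>, only one side shows padding. Equality thus becomes a condition on single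
  columns.\<close>

lemma eq_iff_sym_at_eq:
  assumes "length u \<le> k" and "length v \<le> k"
  shows "u = v \<longleftrightarrow> (\<forall>p<k. sym_at u p = sym_at v p)"
proof
  assume *: "\<forall>p<k. sym_at u p = sym_at v p"
  have "length u = length v"
  proof (rule ccontr)
    assume "length u \<noteq> length v"
    then consider "length u < length v" | "length v < length u"
      by linarith
    then show False
    proof cases
      case 1
      then show False using *[rule_format, of "length u"] assms by (simp add: sym_at_def)
    next
      case 2
      then show False using *[rule_format, of "length v"] assms by (simp add: sym_at_def)
    qed
  qed
  moreover have "u ! p = v ! p" if "p < length u" for p
    using *[rule_format, of p] that assms calculation by (simp add: sym_at_def)
  ultimately show "u = v"
    by (simp add: nth_equalityI)
qed simp

text \<open>A position beyond all components yields \<open>None\<close> and not a tuple of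
  \<open>None\<close>s, since the tensor ends with its longest component.\<close>

lemma sym_at_tensor:
  assumes "us \<noteq> []"
  shows "sym_at (tensor us) p =
    (if \<exists>u\<in>set us. sym_at u p \<noteq> None then Some (map (\<lambda>u. sym_at u p) us) else None)"
proof -
  have "p < Max (length ` set us) \<longleftrightarrow> (\<exists>u\<in>set us. p < length u)"
    using assms by (subst Max_gr_iff) auto
  then show ?thesis
    by (auto simp: sym_at_def tensor_def)
qed

lemma length_tensor_le:
  assumes "us \<noteq> []" and "\<forall>u\<in>set us. length u \<le> k"
  shows "length (tensor us) \<le> k"
  using assms by (simp add: tensor_def)

text \<open>A letter holds all rows at once, so erasing rows or selecting some of them is a
  letter-to-letter map. The length \<open>k\<close> is given separately, so columns consisting of
  padding only may occur.\<close>

definition enc :: "nat \<Rightarrow> ('t \<Rightarrow> 'b list) \<Rightarrow> ('t \<Rightarrow> 'b option) list" where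
  "enc k E = map (\<lambda>p t. sym_at (E t) p) [0..<k]"

lemma length_enc [simp]: "length (enc k E) = k"
  by (simp add: enc_def)

lemma nth_enc [simp]: "p < k \<Longrightarrow> enc k E ! p = (\<lambda>t. sym_at (E t) p)"
  by (simp add: enc_def)

lemma set_enc: "set (enc k E) = (\<lambda>p t. sym_at (E t) p) ` {..<k}"
  by (auto simp: enc_def)

text \<open>Nothing is required of words that do not encode a valuation.\<close>

definition definable :: "(nat \<Rightarrow> ('t \<Rightarrow> 'b list) \<Rightarrow> bool) \<Rightarrow> bool" where
  "definable P \<longleftrightarrow> (\<exists>A. regular A \<and>
     (\<forall>k E. (\<forall>t. length (E t) \<le> k) \<longrightarrow> (enc k E \<in> A \<longleftrightarrow> P k E)))"

lemma definable_cong: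
  assumes "definable P" and "\<And>k E. \<forall>t. length (E t) \<le> k \<Longrightarrow> P k E \<longleftrightarrow> Q k E"
  shows "definable Q"
  using assms unfolding definable_def by simp

text \<open>The map \<open>h\<close> extracts from a column what a condition reads, so automata-like
  conditions can be stated over a smaller alphabet.\<close>

lemma definable_regular:
  "regular A \<Longrightarrow> definable (\<lambda>k E. map h (enc k E) \<in> A)"
  unfolding definable_def using regular_map_vimage[of A h] by blast

lemma definable_not:
  assumes "definable P"
  shows "definable (\<lambda>k E. \<not> P k E)"
proof -
  obtain A where "regular A" "\<forall>k E. (\<forall>t. length (E t) \<le> k) \<longrightarrow> (enc k E \<in> A \<longleftrightarrow> P k E)"
    using assms by (auto simp: definable_def)
  then show ?thesis
    unfolding definable_def by (intro exI[of _ "- A"]) (simp add: regular_Compl)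
qed

lemma definable_conj:
  assumes "definable P" and "definable Q"
  shows "definable (\<lambda>k E. P k E \<and> Q k E)"
proof -
  obtain A B where "regular A" "\<forall>k E. (\<forall>t. length (E t) \<le> k) \<longrightarrow> (enc k E \<in> A \<longleftrightarrow> P k E)"
    "regular B" "\<forall>k E. (\<forall>t. length (E t) \<le> k) \<longrightarrow> (enc k E \<in> B \<longleftrightarrow> Q k E)"
    using assms by (auto simp: definable_def)
  then show ?thesis
    unfolding definable_def by (intro exI[of _ "A \<inter> B"]) (simp add: regular_Int)
qed

lemma definable_pointwise: "definable (\<lambda>k E. \<forall>p<k. P (\<lambda>t. sym_at (E t) p))"
  unfolding definable_def
  by (intro exI[of _ "{x. \<forall>c\<in>set x. P c}"] conjI regular_all_letters) (auto simp: set_enc)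

lemma definable_Ball_finite:
  assumes "finite I" and "\<And>i. i \<in> I \<Longrightarrow> definable (P i)"
  shows "definable (\<lambda>k E. \<forall>i\<in>I. P i k E)"
  using assms
proof (induction I rule: finite_induct)
  case empty
  show ?case
    by (rule definable_cong[OF definable_pointwise[of "\<lambda>_. True"]]) simp
next
  case (insert i I)
  then have "definable (\<lambda>k E. P i k E \<and> (\<forall>i\<in>I. P i k E))"
    by (intro definable_conj) auto
  then show ?case
    by simp
qed

section \<open>Decoding rows and existential quantification\<close>

definition decode_track :: "'t \<Rightarrow> ('t \<Rightarrow> 'b option) list \<Rightarrow> 'b list" where
  "decode_track t x = map the (takeWhile (\<lambda>s. s \<noteq> None) (map (\<lambda>c. c t) x))"

lemma length_decode_track: "length (decode_track t x) \<le> length x"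
  unfolding decode_track_def by (metis length_map length_takeWhile_le)

text \<open>Since padding never ends once begun, the \<open>takeWhile\<close> in
  \<open>decode_track\<close> cuts off nothing but padding.\<close>

lemma sym_at_decode_track:
  assumes "sorted_wrt (\<lambda>c c'. c t = None \<longrightarrow> c' t = None) x" and "p < length x"
  shows "sym_at (decode_track t x) p = (x ! p) t"
  using assms
proof (induction x arbitrary: p)
  case (Cons c x)
  show ?case
  proof (cases "c t = None")
    case True
    then have "\<forall>c'\<in>set (c # x). c' t = None"
      using Cons.prems(1) by simp
    then have "((c # x) ! p) t = None"
      using Cons.prems(2) nth_mem by blast
    then show ?thesis
      using True by (simp add: decode_track_def sym_at_def)
  next
    case False
    then have "decode_track t (c # x) = the (c t) # decode_track t x"
      by (simp add: decode_track_def)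
    then show ?thesis
      using Cons.IH[of "p - 1"] Cons.prems False by (cases p) (auto simp: sym_at_def)
  qed
qed simp

lemma sorted_enc: "sorted_wrt (\<lambda>c c'. c t = None \<longrightarrow> c' t = None) (enc k E)"
  by (auto simp: sorted_wrt_iff_nth_less sym_at_eq_None_iff)

text \<open>Projection: a word qualifies if it agrees outside \<open>T\<close> with some word for
  \<open>P\<close>. Both words have length \<open>k\<close>, which is where the bound on the
  quantified strings comes from.\<close>

lemma definable_ex:
  assumes "definable P" and "finite T"
  shows "definable (\<lambda>k E. \<exists>E'. (\<forall>t. t \<notin> T \<longrightarrow> E' t = E t) \<and> (\<forall>t. length (E' t) \<le> k) \<and> P k E')"
proof -
  obtain A where A: "regular A" "\<And>k E. \<forall>t. length (E t) \<le> k \<Longrightarrow> enc k E \<in> A \<longleftrightarrow> P k E"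
    using assms by (auto simp: definable_def)
  \<comment> \<open>\<open>A\<close> is arbitrary on words that encode nothing, so the witness word
    must be required to have decodable rows in \<open>T\<close>.\<close>
  define W where "W = (\<Inter>t\<in>T. {x :: ('a \<Rightarrow> 'b option) list. sorted_wrt (\<lambda>c c'. c t = None \<longrightarrow> c' t = None) x})"
  define erase :: "('a \<Rightarrow> 'b option) \<Rightarrow> 'a \<Rightarrow> 'b option" where "erase c = (\<lambda>t. if t \<in> T then None else c t)" for c
  \<comment> \<open>Erasing on both sides makes membership independent of what the given word has in
    the rows of \<open>T\<close>.\<close>
  let ?B = "{x. map erase x \<in> map erase ` (A \<inter> W)}"
  have "regular W"
    unfolding W_def using assms(2) by (intro regular_Inter_finite regular_sorted_wrt)
  then have "regular ?B"
    using A(1) by (intro regular_map_vimage regular_map_image regular_Int)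
  moreover have "enc k E \<in> ?B \<longleftrightarrow>
      (\<exists>E'. (\<forall>t. t \<notin> T \<longrightarrow> E' t = E t) \<and> (\<forall>t. length (E' t) \<le> k) \<and> P k E')"
    if E: "\<forall>t. length (E t) \<le> k" for k E
  proof
    assume "enc k E \<in> ?B"
    then obtain y where y: "y \<in> A" "y \<in> W" "map erase (enc k E) = map erase y"
      by auto
    have len: "length y = k"
      using y(3) by (metis length_enc length_map)
    define E' where "E' t = (if t \<in> T then decode_track t y else E t)" for t
    have E': "\<forall>t. length (E' t) \<le> k"
      using E length_decode_track[of _ y] len by (simp add: E'_def)
    have "sym_at (E' t) p = (y ! p) t" if "p < k" for t p
    proof (cases "t \<in> T")
      case False
      have "map erase (enc k E) ! p = map erase y ! p"
        using y(3) by simp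
      then have "erase (\<lambda>t. sym_at (E t) p) t = erase (y ! p) t"
        using that len by simp
      then show ?thesis
        using False by (simp add: E'_def erase_def)
    next
      case True
      then show ?thesis
        using y(2) that len by (simp add: E'_def W_def sym_at_decode_track)
    qed
    then have "enc k E' = y"
      using len by (intro nth_equalityI) auto
    then have "P k E'"
      using A(2)[OF E'] y(1) by simp
    then show "\<exists>E'. (\<forall>t. t \<notin> T \<longrightarrow> E' t = E t) \<and> (\<forall>t. length (E' t) \<le> k) \<and> P k E'"
      using E' by (intro exI[of _ E']) (simp add: E'_def)
  next
    assume "\<exists>E'. (\<forall>t. t \<notin> T \<longrightarrow> E' t = E t) \<and> (\<forall>t. length (E' t) \<le> k) \<and> P k E'"
    then obtain E' where E': "\<forall>t. t \<notin> T \<longrightarrow> E' t = E t" "\<forall>t. length (E' t) \<le> k" "P k E'"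
      by blast
    have "enc k E' \<in> A \<inter> W"
      using A(2) E' by (auto simp: W_def sorted_enc)
    moreover have "map erase (enc k E) = map erase (enc k E')"
      using E'(1) by (intro nth_equalityI) (auto simp: erase_def fun_eq_iff)
    ultimately show "enc k E \<in> ?B"
      by auto
  qed
  ultimately show ?thesis
    unfolding definable_def by blast
qed

lemma definable_ex1:
  assumes "definable P"
  shows "definable (\<lambda>k E. \<exists>d. length d \<le> k \<and> P k (E(t := d)))"
proof (rule definable_cong[OF definable_ex[OF assms, of "{t}"]])
  fix k :: nat and E :: "'a \<Rightarrow> 'b list"
  assume E: "\<forall>t. length (E t) \<le> k"
  show "(\<exists>E'. (\<forall>t'. t' \<notin> {t} \<longrightarrow> E' t' = E t') \<and> (\<forall>t. length (E' t) \<le> k) \<and> P k E') \<longleftrightarrow>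
    (\<exists>d. length d \<le> k \<and> P k (E(t := d)))" (is "?l \<longleftrightarrow> ?r")
  proof
    assume ?l
    then obtain E' where E': "\<forall>t'. t' \<noteq> t \<longrightarrow> E' t' = E t'" "\<forall>t. length (E' t) \<le> k" "P k E'"
      by auto
    then have "E' = E(t := E' t)"
      by auto
    then show ?r
      using E' by metis
  next
    assume ?r
    then obtain d where "length d \<le> k" "P k (E(t := d))"
      by blast
    then show ?l
      using E by (intro exI[of _ "E(t := d)"]) auto
  qed
qed simp

text \<open>Passing from a predicate to a language requires discarding non-encodings:
  \<open>W\<close> makes the rows in \<open>T\<close> decodable and \<open>?Z\<close> empties all
  others. Finiteness of \<open>T\<close> keeps \<open>W\<close> a finite intersection.\<close>

lemma regular_definable_image:
  assumes "definable P" and "finite T"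
  shows "regular {enc k E | k E. (\<forall>t. length (E t) \<le> k) \<and> (\<forall>t. t \<notin> T \<longrightarrow> E t = []) \<and> P k E}"
    (is "regular ?L")
proof -
  obtain A where A: "regular A" "\<And>k E. \<forall>t. length (E t) \<le> k \<Longrightarrow> enc k E \<in> A \<longleftrightarrow> P k E"
    using assms by (auto simp: definable_def)
  define W where "W = (\<Inter>t\<in>T. {x :: ('a \<Rightarrow> 'b option) list. sorted_wrt (\<lambda>c c'. c t = None \<longrightarrow> c' t = None) x})"
  let ?Z = "{x :: ('a \<Rightarrow> 'b option) list. \<forall>c\<in>set x. \<forall>t. t \<notin> T \<longrightarrow> c t = None}"
  have "regular W"
    unfolding W_def using assms(2) by (intro regular_Inter_finite regular_sorted_wrt)
  then have "regular (A \<inter> (W \<inter> ?Z))"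
    using A(1) by (intro regular_Int regular_all_letters)
  also have "A \<inter> (W \<inter> ?Z) = ?L"
  proof (intro equalityI subsetI)
    fix x
    assume x: "x \<in> A \<inter> (W \<inter> ?Z)"
    define E where "E t = (if t \<in> T then decode_track t x else [])" for t
    have E: "\<forall>t. length (E t) \<le> length x"
      by (simp add: E_def length_decode_track)
    have "sym_at (E t) p = (x ! p) t" if "p < length x" for t p
    proof (cases "t \<in> T")
      case True
      then show ?thesis
        using x that by (simp add: E_def W_def sym_at_decode_track)
    next
      case False
      then show ?thesis
        using x nth_mem[OF that] by (auto simp: E_def sym_at_def)
    qed
    then have "enc (length x) E = x"
      by (intro nth_equalityI) auto
    moreover from this have "P (length x) E"
      using A(2)[OF E] x by simp
    moreover have "\<forall>t. t \<notin> T \<longrightarrow> E t = []"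
      by (simp add: E_def)
    ultimately show "x \<in> ?L"
      using E by (auto intro!: exI[of _ "length x"] exI[of _ E])
  next
    fix x
    assume "x \<in> ?L"
    then show "x \<in> A \<inter> (W \<inter> ?Z)"
      using A(2) by (auto simp: W_def sorted_enc set_enc sym_at_def)
  qed
  finally show ?thesis .
qed

section \<open>Decision diagrams\<close>

lemma layers_edges_bound:
  assumes "D \<in> odds \<Gamma> w k" "i < k" "(p, s, q) \<in> edges (D ! i)"
  shows "p < w" "q < w" "s \<in> with_pad \<Gamma>"
proof -
  have "D ! i \<in> layers \<Gamma> w"
    using assms(1,2) by (auto simp: odds_def)
  then show "p < w" "q < w" "s \<in> with_pad \<Gamma>"
    using assms(3) by (auto simp: layers_def)
qed

lemma odd_lang_subset_strings:
  assumes "D \<in> odds \<Gamma> w k"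
  shows "odd_lang D \<subseteq> nonempty_strings \<Gamma>"
proof
  fix s
  assume "s \<in> odd_lang D"
  then obtain p q where s: "s \<noteq> []" "length s \<le> length D"
    and pq: "\<forall>i<length D. (p i, sym_at s i, q i) \<in> edges (D ! i)"
    by (auto simp: odd_lang_def)
  have "length D = k"
    using assms by (simp add: odds_def)
  have "s ! i \<in> \<Gamma>" if "i < length s" for i
  proof -
    have "sym_at s i \<in> with_pad \<Gamma>"
      using pq that s(2) \<open>length D = k\<close> by (intro layers_edges_bound(3)[OF assms, of i "p i" _ "q i"]) auto
    then show ?thesis
      using that by (auto simp: with_pad_def sym_at_def)
  qed
  then show "s \<in> nonempty_strings \<Gamma>"
    using s(1) by (auto simp: nonempty_strings_def in_set_conv_nth)
qed

text \<open>A diagram is a run whose states are the sets of nodes between consecutive layers, drawn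
  from the finite set \<open>Pow {..<w}\<close>; the two flags of \<open>regular_runs\<close> check
  \<open>is_first\<close> and \<open>is_last\<close>.\<close>

lemma regular_odds: "regular {D. D \<noteq> [] \<and> D \<in> odds \<Gamma> w (length D)}"
proof -
  let ?\<delta> = "\<lambda>f l A B A'. B \<in> layers \<Gamma> w \<and> is_first B = f \<and> is_last B = l \<and> lft B = A \<and> rgt B = A'"
  let ?run = "\<lambda>D \<rho>. (\<forall>i\<le>length D. \<rho> i \<in> Pow {..<w}) \<and>
    (\<forall>i<length D. ?\<delta> (i = 0) (Suc i = length D) (\<rho> i) (D ! i) (\<rho> (Suc i)))"
  have "D \<in> odds \<Gamma> w (length D) \<longleftrightarrow> (\<exists>\<rho>. ?run D \<rho>)" if "D \<noteq> []" for D
  proof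
    assume D: "D \<in> odds \<Gamma> w (length D)"
    \<comment> \<open>The second case serves the end point \<open>i = length D\<close>, which is not
      the left side of any layer.\<close>
    define \<rho> where "\<rho> i = (if i < length D then lft (D ! i) else rgt (D ! (i - 1)))" for i
    have mem: "D ! i \<in> layers \<Gamma> w" if "i < length D" for i
      using D that by (auto simp: odds_def)
    have "\<rho> i \<in> Pow {..<w}" if "i \<le> length D" for i
    proof (cases "i < length D")
      case True
      then show ?thesis
        using mem[of i] by (auto simp: \<rho>_def layers_def)
    next
      case False
      then show ?thesis
        using mem[of "i - 1"] that \<open>D \<noteq> []\<close> by (auto simp: \<rho>_def layers_def)
    qed
    moreover have "?\<delta> (i = 0) (Suc i = length D) (\<rho> i) (D ! i) (\<rho> (Suc i))" if "i < length D" for i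
      using D mem[of i] that by (simp add: \<rho>_def odds_def)
    ultimately show "\<exists>\<rho>. ?run D \<rho>"
      by (intro exI[of _ \<rho>]) blast
  next
    assume "\<exists>\<rho>. ?run D \<rho>"
    then obtain \<rho> where \<rho>: "?run D \<rho>"
      by (elim exE)
    then have "set D \<subseteq> layers \<Gamma> w"
      by (auto simp: in_set_conv_nth)
    moreover have "lft (D ! Suc i) = rgt (D ! i)" if "Suc i < length D" for i
      using \<rho> that by auto
    ultimately show "D \<in> odds \<Gamma> w (length D)"
      using \<rho> unfolding odds_def by blast
  qed
  then have "{D. D \<noteq> [] \<and> D \<in> odds \<Gamma> w (length D)} = {D. D \<noteq> [] \<and> (\<exists>\<rho>. ?run D \<rho>)}"
    by blast
  also have "regular \<dots>"
    by (rule regular_runs) simp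
  finally show ?thesis .
qed

text \<open>The sequences \<open>p\<close> and \<open>q\<close> of \<open>odd_lang\<close> are
  merged into one sequence of \<open>k + 1\<close> nodes, and the end conditions are attached to the
  first and last step, as \<open>regular_runs\<close> expects.\<close>

lemma odd_lang_iff_run:
  assumes D: "D \<in> odds \<Gamma> w k" and k: "1 \<le> k" "length s \<le> k"
  shows "s \<in> odd_lang D \<longleftrightarrow> s \<noteq> [] \<and> (\<exists>\<rho>. (\<forall>i\<le>k. \<rho> i \<in> {..<w}) \<and>
    (\<forall>i<k. (\<rho> i, sym_at s i, \<rho> (Suc i)) \<in> edges (D ! i) \<and>
      (i = 0 \<longrightarrow> \<rho> i \<in> init (D ! i)) \<and> (Suc i = k \<longrightarrow> \<rho> (Suc i) \<in> final (D ! i))))"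
    (is "_ \<longleftrightarrow> _ \<and> (\<exists>\<rho>. ?run \<rho>)")
proof -
  have len: "length D = k"
    using D by (simp add: odds_def)
  show ?thesis
  proof
    assume "s \<in> odd_lang D"
    then obtain p q where s: "s \<noteq> []" and pq: "\<forall>i<k. (p i, sym_at s i, q i) \<in> edges (D ! i)"
      "\<forall>i. Suc i < k \<longrightarrow> p (Suc i) = q i" "p 0 \<in> init (D ! 0)" "q (k - 1) \<in> final (D ! (k - 1))"
      unfolding odd_lang_def len by blast
    define \<rho> where "\<rho> i = (if i < k then p i else q (i - 1))" for i
    have p: "\<rho> i = p i" and q: "\<rho> (Suc i) = q i" if "i < k" for i
      using that pq(2) by (auto simp: \<rho>_def)
    have "\<rho> i \<in> {..<w}" if "i \<le> k" for i
    proof (cases i)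
      case 0
      then show ?thesis
        using layers_edges_bound(1)[OF D, of 0 "p 0" "sym_at s 0" "q 0"] pq(1) k p by simp
    next
      case (Suc j)
      then show ?thesis
        using layers_edges_bound(2)[OF D, of j "p j" "sym_at s j" "q j"] pq(1) that q by simp
    qed
    moreover have "(\<rho> i, sym_at s i, \<rho> (Suc i)) \<in> edges (D ! i) \<and>
      (i = 0 \<longrightarrow> \<rho> i \<in> init (D ! i)) \<and> (Suc i = k \<longrightarrow> \<rho> (Suc i) \<in> final (D ! i))" if "i < k" for i
      using pq p[OF that] q[OF that] that by auto
    ultimately show "s \<noteq> [] \<and> (\<exists>\<rho>. ?run \<rho>)"
      using s by (intro conjI exI[of _ \<rho>]) simp_all
  next
    assume "s \<noteq> [] \<and> (\<exists>\<rho>. ?run \<rho>)"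
    then obtain \<rho> where s: "s \<noteq> []" and \<rho>: "?run \<rho>"
      by blast
    have "\<rho> 0 \<in> init (D ! 0)" "\<rho> (Suc (k - 1)) \<in> final (D ! (k - 1))"
      using \<rho> k(1) by auto
    then show "s \<in> odd_lang D"
      unfolding odd_lang_def len using \<rho> s k(2)
      by (intro CollectI conjI exI[of _ \<rho>] exI[of _ "\<lambda>i. \<rho> (Suc i)"]) simp_all
  qed
qed

section \<open>Definable conditions on diagrams and strings\<close>

text \<open>Absence of padding in row \<open>t\<close> forces the row to have length exactly
  \<open>k\<close>, and only then does \<open>the\<close> in the column map return actual
  layers.\<close>

lemma definable_odds:
  "definable (\<lambda>k E. 1 \<le> k \<and> map f (E t) \<in> odds \<Gamma> w k)"
proof (rule definable_cong[OF definable_conj[OF definable_pointwise definable_regular[OF regular_odds]]])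
  fix k and E :: "'a \<Rightarrow> 'b list"
  assume E: "\<forall>t. length (E t) \<le> k"
  let ?h = "\<lambda>c. f (the (c t))"
  show "(\<forall>p<k. sym_at (E t) p \<noteq> None) \<and> map ?h (enc k E) \<in> {D. D \<noteq> [] \<and> D \<in> odds \<Gamma> w (length D)} \<longleftrightarrow>
    1 \<le> k \<and> map f (E t) \<in> odds \<Gamma> w k"
  proof (cases "length (E t) = k")
    case True
    then have "map ?h (enc k E) = map f (E t)"
      by (intro nth_equalityI) (simp_all add: sym_at_def)
    then show ?thesis
      using True by (cases "E t") (auto simp: sym_at_def)
  next
    case False
    then have "length (E t) < k"
      using E by (simp add: le_neq_implies_less)
    then show ?thesis
      using False by (auto simp: odds_def sym_at_eq_None_iff)
  qed
qed

text \<open>Row \<open>t\<close> supplies the layer and row \<open>t'\<close> the padded symbol of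
  each column, and a run goes through nodes below \<open>w\<close>. That row \<open>t'\<close> is
  nonempty is a separate conjunct.\<close>

lemma definable_odd_lang:
  "definable (\<lambda>k E. 1 \<le> k \<and> map f (E t) \<in> odds \<Gamma> w k \<and> map g (E t') \<in> odd_lang (map f (E t)))"
proof -
  let ?\<delta> = "\<lambda>b l p (B, s) q. (p, s, q) \<in> edges B \<and> (b \<longrightarrow> p \<in> init B) \<and> (l \<longrightarrow> q \<in> final B)"
  let ?A = "{x. x \<noteq> [] \<and> (\<exists>\<rho>. (\<forall>i\<le>length x. \<rho> i \<in> {..<w}) \<and>
    (\<forall>i<length x. ?\<delta> (i = 0) (Suc i = length x) (\<rho> i) (x ! i) (\<rho> (Suc i))))}"
  let ?h = "\<lambda>c. (f (the (c t)), map_option g (c t'))"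
  have A: "regular ?A"
    by (rule regular_runs) simp
  have ne: "definable (\<lambda>k E. \<not> (\<forall>p<k. sym_at (E t') p = None))"
    by (intro definable_not definable_pointwise)
  show ?thesis
  proof (rule definable_cong[OF definable_conj[OF definable_odds[of f t \<Gamma> w]
        definable_conj[OF ne definable_regular[OF A, of ?h]]]])
    fix k and E :: "'a \<Rightarrow> 'b list"
    assume E: "\<forall>t. length (E t) \<le> k"
    show "(1 \<le> k \<and> map f (E t) \<in> odds \<Gamma> w k) \<and>
        \<not> (\<forall>p<k. sym_at (E t') p = None) \<and> map ?h (enc k E) \<in> ?A \<longleftrightarrow>
      1 \<le> k \<and> map f (E t) \<in> odds \<Gamma> w k \<and> map g (E t') \<in> odd_lang (map f (E t))"
    proof (cases "1 \<le> k \<and> map f (E t) \<in> odds \<Gamma> w k")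
      case True
      then have k: "1 \<le> k" and D: "map f (E t) \<in> odds \<Gamma> w k" and len: "length (E t) = k"
        by (auto simp: odds_def)
      have "map ?h (enc k E) ! i = (map f (E t) ! i, sym_at (map g (E t')) i)" if "i < k" for i
        using that len by (simp add: sym_at_map) (simp add: sym_at_def)
      moreover have "map ?h (enc k E) \<noteq> []"
        using k by (simp add: enc_def)
      moreover have "(\<forall>p<k. sym_at (E t') p = None) \<longleftrightarrow> map g (E t') = []"
        using E[rule_format, of t'] k by (auto simp: sym_at_eq_None_iff)
      moreover have "length (map g (E t')) \<le> k"
        using E by simp
      ultimately show ?thesis
        using True odd_lang_iff_run[OF D k, of "map g (E t')"] by simp
    qed blast
  qed
qed

text \<open>By \<open>sym_at_tensor\<close> this is a condition on single columns. The list
  \<open>js\<close> may repeat indices, as the arguments of an atomic formula may.\<close>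

lemma definable_tensor:
  fixes f :: "'b \<Rightarrow> 'c" and v :: "'j \<Rightarrow> 't"
  assumes "js \<noteq> []"
  shows "definable (\<lambda>k E. map g (E t) = tensor (map (\<lambda>j. map f (E (v j))) js))"
proof -
  let ?P = "\<lambda>c. map_option g (c t) = (if \<exists>j\<in>set js. c (v j) \<noteq> None
    then Some (map (\<lambda>j. map_option f (c (v j))) js) else None)"
  show ?thesis
  proof (rule definable_cong[OF definable_pointwise[of ?P]])
    fix k and E :: "'t \<Rightarrow> 'b list"
    assume E: "\<forall>t. length (E t) \<le> k"
    let ?us = "map (\<lambda>j. map f (E (v j))) js"
    have ne: "?us \<noteq> []"
      using assms by simp
    have "map g (E t) = tensor ?us \<longleftrightarrow> (\<forall>p<k. sym_at (map g (E t)) p = sym_at (tensor ?us) p)"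
      using E ne by (intro eq_iff_sym_at_eq length_tensor_le) auto
    then show "(\<forall>p<k. ?P (\<lambda>t. sym_at (E t) p)) \<longleftrightarrow> map g (E t) = tensor ?us"
      unfolding sym_at_tensor[OF ne] by (simp add: sym_at_map comp_def)
  qed
qed

lemma definable_eq: "definable (\<lambda>k E. map f (E t) = map f (E t'))"
proof (rule definable_cong[OF definable_pointwise[of "\<lambda>c. map_option f (c t) = map_option f (c t')"]])
  fix k and E :: "'a \<Rightarrow> 'b list"
  assume "\<forall>t. length (E t) \<le> k"
  then show "(\<forall>p<k. map_option f (sym_at (E t) p) = map_option f (sym_at (E t') p)) \<longleftrightarrow>
    map f (E t) = map f (E t')"
    using eq_iff_sym_at_eq[of "map f (E t)" k "map f (E t')"] by (simp add: sym_at_map)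
qed

lemma in_listset_iff: "us \<in> listset Ss \<longleftrightarrow> list_all2 (\<in>) us Ss"
proof (induction Ss arbitrary: us)
  case (Cons S Ss)
  then show ?case
    by (cases us) (auto simp: set_Cons_def)
qed simp

lemma in_listset_replicate_iff: "us \<in> listset (replicate a L) \<longleftrightarrow> length us = a \<and> set us \<subseteq> L"
  by (auto simp: in_listset_iff list_all2_conv_all_nth in_set_conv_nth subset_iff)

section \<open>First-order formulas over derived structures\<close>

text \<open>Rows for the domain diagram, the relation diagrams and the variables, and one auxiliary
  row for strings over a tensor alphabet.\<close>

datatype track = DomT | RelT nat | VarT nat | AuxT

text \<open>One symbol type for all rows, as \<open>enc\<close> demands. Rows are not forced to use
  their own constructor: only what the selectors return is ever read.\<close>

datatype 'a cell =
    DomC (the_dom: "'a layer")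
  | RelC (the_rel: "'a option list layer")
  | VarC (the_letter: 'a)
  | ColC (the_col: "'a option list")

definition dom_odd :: "(track \<Rightarrow> 'a cell list) \<Rightarrow> 'a layer list" where
  "dom_odd E = map the_dom (E DomT)"

definition rel_odd :: "(track \<Rightarrow> 'a cell list) \<Rightarrow> nat \<Rightarrow> 'a option list layer list" where
  "rel_odd E i = map the_rel (E (RelT i))"

definition var_string :: "(track \<Rightarrow> 'a cell list) \<Rightarrow> nat \<Rightarrow> 'a list" where
  "var_string E j = map the_letter (E (VarT j))"

text \<open>Being structural except for the inclusions of languages. This part alone guarantees the
  length bounds needed in the induction on formulas.\<close>

definition odd_tuple :: "bool \<Rightarrow> 'a set \<Rightarrow> nat \<Rightarrow> nat list \<Rightarrow> nat \<Rightarrow> (track \<Rightarrow> 'a cell list) \<Rightarrow> bool" where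
  "odd_tuple padded \<Sigma> w \<tau> k E \<longleftrightarrow> 1 \<le> k \<and> dom_odd E \<in> odds \<Sigma> w k \<and>
     (\<forall>i<length \<tau>. rel_odd E i \<in> odds (tensor_alphabet padded (replicate (\<tau> ! i) \<Sigma>)) w k)"

definition derived :: "nat list \<Rightarrow> (track \<Rightarrow> 'a cell list) \<Rightarrow> 'a list fo_structure" where
  "derived \<tau> E = derived_structure \<tau> (dom_odd E) (map (rel_odd E) [0..<length \<tau>])"

lemma definable_odd_tuple: "definable (odd_tuple padded \<Sigma> w \<tau>)"
proof (rule definable_cong)
  show "definable (\<lambda>k E. (1 \<le> k \<and> map the_dom (E DomT) \<in> odds \<Sigma> w k) \<and>
    (\<forall>i\<in>{..<length \<tau>}. 1 \<le> k \<and>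
      map the_rel (E (RelT i)) \<in> odds (tensor_alphabet padded (replicate (\<tau> ! i) \<Sigma>)) w k))"
    by (intro definable_conj definable_Ball_finite definable_odds) simp
qed (auto simp: odd_tuple_def dom_odd_def rel_odd_def)

lemma length_odd_lang: "s \<in> odd_lang D \<Longrightarrow> D \<in> odds \<Gamma> w k \<Longrightarrow> length s \<le> k"
  by (auto simp: odd_lang_def odds_def)

section \<open>The inclusion condition of structural tuples\<close>

text \<open>The components of the tensor are guessed in the first \<open>a\<close> variable rows,
  which serve as scratch space: they are quantified away, so their original content is
  irrelevant.\<close>

lemma definable_mem_tensor_lang:
  assumes "1 \<le> a"
  shows "definable (\<lambda>k E. 1 \<le> k \<and> dom_odd E \<in> odds \<Sigma> w k \<and>
    map the_col (E AuxT) \<in> tensor_lang (replicate a (odd_lang (dom_odd E))))"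
proof (rule definable_cong)
  let ?P = "\<lambda>k E. (\<forall>j\<in>{..<a}. 1 \<le> k \<and> map the_dom (E DomT) \<in> odds \<Sigma> w k \<and>
      map the_letter (E (VarT j)) \<in> odd_lang (map the_dom (E DomT))) \<and>
    map the_col (E AuxT) = tensor (map (\<lambda>j. map the_letter (E (VarT j))) [0..<a])"
  show "definable (\<lambda>k E. \<exists>E'. (\<forall>t. t \<notin> VarT ` {..<a} \<longrightarrow> E' t = E t) \<and>
    (\<forall>t. length (E' t) \<le> k) \<and> ?P k E')"
    using assms
    by (intro definable_ex definable_conj definable_Ball_finite definable_odd_lang definable_tensor) auto
  fix k and E :: "track \<Rightarrow> 'a cell list"
  assume E: "\<forall>t. length (E t) \<le> k"
  show "(\<exists>E'. (\<forall>t. t \<notin> VarT ` {..<a} \<longrightarrow> E' t = E t) \<and> (\<forall>t. length (E' t) \<le> k) \<and> ?P k E') \<longleftrightarrow>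
    1 \<le> k \<and> dom_odd E \<in> odds \<Sigma> w k \<and>
    map the_col (E AuxT) \<in> tensor_lang (replicate a (odd_lang (dom_odd E)))" (is "?l \<longleftrightarrow> ?r")
  proof
    assume ?l
    then obtain E' where E': "\<forall>t. t \<notin> VarT ` {..<a} \<longrightarrow> E' t = E t" "?P k E'"
      by (elim exE conjE) blast
    let ?us = "map (\<lambda>j. map the_letter (E' (VarT j))) [0..<a]"
    have eq: "E' DomT = E DomT" "E' AuxT = E AuxT"
      using E'(1) by auto
    \<comment> \<open>The condition on the diagram stands inside the quantifier over
      \<open>j < a\<close>; \<open>1 \<le> a\<close> allows taking \<open>j = 0\<close>.\<close>
    have "1 \<le> k \<and> dom_odd E \<in> odds \<Sigma> w k"
      using conjunct1[OF E'(2)[unfolded eq], rule_format, of 0] assms by (simp add: dom_odd_def)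
    moreover have "?us \<in> listset (replicate a (odd_lang (dom_odd E)))"
      using E'(2) unfolding dom_odd_def eq in_listset_replicate_iff by auto
    moreover have "map the_col (E AuxT) = tensor ?us"
      using E'(2) unfolding eq by blast
    ultimately show ?r
      by (auto simp: tensor_lang_def)
  next
    assume r: ?r
    then obtain us where us: "length us = a" "set us \<subseteq> odd_lang (dom_odd E)"
      "map the_col (E AuxT) = tensor us"
      by (auto simp: tensor_lang_def in_listset_replicate_iff)
    \<comment> \<open>The components fit into rows of length at most \<open>k\<close> because the
      domain diagram accepts them.\<close>
    define E' where "E' t = (case t of VarT j \<Rightarrow> if j < a then map VarC (us ! j) else E t | _ \<Rightarrow> E t)" for t
    have mem: "us ! j \<in> odd_lang (dom_odd E)" if "j < a" for j
      using us(1,2) that by auto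
    have var: "map the_letter (E' (VarT j)) = us ! j" if "j < a" for j
      using that by (simp add: E'_def comp_def)
    have eq: "E' DomT = E DomT" "E' AuxT = E AuxT"
      by (simp_all add: E'_def)
    have "length (E' t) \<le> k" for t
      using E length_odd_lang[OF mem] r by (auto simp: E'_def split: track.splits)
    moreover have "map (\<lambda>j. map the_letter (E' (VarT j))) [0..<a] = us"
      using us(1) var by (intro nth_equalityI) auto
    then have "?P k E'"
      using us(3) r var mem unfolding eq dom_odd_def[symmetric] by auto
    moreover have "E' t = E t" if "t \<notin> VarT ` {..<a}" for t
      using that by (auto simp: E'_def split: track.splits)
    ultimately show ?l
      by (intro exI[of _ E']) blast
  qed
qed

text \<open>An inclusion is the absence of a counterexample in the auxiliary row. Any counterexample
  is accepted by a diagram of length \<open>k\<close>, so the bound on \<open>d\<close> loses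
  none.\<close>

lemma definable_structural:
  assumes "\<forall>a\<in>set \<tau>. 1 \<le> a"
  shows "definable (\<lambda>k E. odd_tuple padded \<Sigma> w \<tau> k E \<and> (\<forall>i<length \<tau>.
    odd_lang (rel_odd E i) \<subseteq> tensor_lang (replicate (\<tau> ! i) (odd_lang (dom_odd E)))))"
proof (rule definable_cong)
  let ?\<Gamma> = "\<lambda>i. tensor_alphabet padded (replicate (\<tau> ! i) \<Sigma>)"
  let ?A = "\<lambda>i k E. 1 \<le> k \<and> map the_rel (E (RelT i)) \<in> odds (?\<Gamma> i) w k \<and>
    map the_col (E AuxT) \<in> odd_lang (map the_rel (E (RelT i)))"
  let ?B = "\<lambda>i k E. 1 \<le> k \<and> dom_odd E \<in> odds \<Sigma> w k \<and>
    map the_col (E AuxT) \<in> tensor_lang (replicate (\<tau> ! i) (odd_lang (dom_odd E)))"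
  show "definable (\<lambda>k E. odd_tuple padded \<Sigma> w \<tau> k E \<and> (\<forall>i\<in>{..<length \<tau>}.
    \<not> (\<exists>d. length d \<le> k \<and> ?A i k (E(AuxT := d)) \<and> \<not> ?B i k (E(AuxT := d)))))"
    using assms
    by (intro definable_conj definable_odd_tuple definable_Ball_finite definable_not
        definable_ex1[of "\<lambda>k E. ?A _ k E \<and> \<not> ?B _ k E"] definable_odd_lang definable_mem_tensor_lang) auto
  fix k and E :: "track \<Rightarrow> 'a cell list"
  assume E: "\<forall>t. length (E t) \<le> k"
  have "(\<exists>d. length d \<le> k \<and> ?A i k (E(AuxT := d)) \<and> \<not> ?B i k (E(AuxT := d))) \<longleftrightarrow>
    \<not> odd_lang (rel_odd E i) \<subseteq> tensor_lang (replicate (\<tau> ! i) (odd_lang (dom_odd E)))" (is "?l \<longleftrightarrow> ?r")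
    if i: "i < length \<tau>" and ok: "odd_tuple padded \<Sigma> w \<tau> k E" for i
  proof
    assume ?l
    then show ?r
      using ok by (auto simp: odd_tuple_def dom_odd_def rel_odd_def)
  next
    assume ?r
    then obtain s where s: "s \<in> odd_lang (rel_odd E i)"
      "s \<notin> tensor_lang (replicate (\<tau> ! i) (odd_lang (dom_odd E)))"
      by blast
    have ok': "1 \<le> k" "rel_odd E i \<in> odds (?\<Gamma> i) w k" "dom_odd E \<in> odds \<Sigma> w k"
      using ok i by (auto simp: odd_tuple_def)
    then show ?l
      using s length_odd_lang[OF s(1) ok'(2)]
      by (intro exI[of _ "map ColC s"]) (auto simp: dom_odd_def rel_odd_def comp_def)
  qed
  then show "(odd_tuple padded \<Sigma> w \<tau> k E \<and> (\<forall>i\<in>{..<length \<tau>}.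
      \<not> (\<exists>d. length d \<le> k \<and> ?A i k (E(AuxT := d)) \<and> \<not> ?B i k (E(AuxT := d))))) \<longleftrightarrow>
    (odd_tuple padded \<Sigma> w \<tau> k E \<and> (\<forall>i<length \<tau>.
      odd_lang (rel_odd E i) \<subseteq> tensor_lang (replicate (\<tau> ! i) (odd_lang (dom_odd E)))))"
    by (simp only: lessThan_iff Ball_def not_not cong: conj_cong imp_cong)
qed

section \<open>Definability of satisfaction\<close>

text \<open>The coincidence lemma, used to exchange \<open>var_string E\<close> for the valuation
  that indexes a list of \<open>n\<close> strings.\<close>

lemma sat_cong_free_vars:
  assumes "\<And>x. x \<in> free_vars \<phi> \<Longrightarrow> e x = e' x"
  shows "sat S e \<phi> \<longleftrightarrow> sat S e' \<phi>"
  using assms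
proof (induction \<phi> arbitrary: e e')
  case (Rel i xs)
  then have "map e xs = map e' xs"
    by simp
  then show ?case
    by (simp only: sat.simps)
next
  case (Neg \<phi>)
  then show ?case
    by (metis free_vars.simps(3) sat.simps(3))
next
  case (Conj \<phi> \<psi>)
  have "sat S e \<phi> \<longleftrightarrow> sat S e' \<phi>" "sat S e \<psi> \<longleftrightarrow> sat S e' \<psi>"
    by (rule Conj.IH; use Conj.prems in simp)+
  then show ?case
    by simp
next
  case (Disj \<phi> \<psi>)
  have "sat S e \<phi> \<longleftrightarrow> sat S e' \<phi>" "sat S e \<psi> \<longleftrightarrow> sat S e' \<psi>"
    by (rule Disj.IH; use Disj.prems in simp)+
  then show ?case
    by simp
next
  case (Exists x \<phi>)
  have "sat S (e(x := d)) \<phi> \<longleftrightarrow> sat S (e'(x := d)) \<phi>" for d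
    by (rule Exists.IH) (use Exists.prems in simp)
  then show ?case
    by simp
next
  case (Forall x \<phi>)
  have "sat S (e(x := d)) \<phi> \<longleftrightarrow> sat S (e'(x := d)) \<phi>" for d
    by (rule Forall.IH) (use Forall.prems in simp)
  then show ?case
    by simp
qed simp

lemma track_update_simps [simp]:
  "dom_odd (E(VarT x := d)) = dom_odd E"
  "rel_odd (E(VarT x := d)) = rel_odd E"
  "var_string (E(VarT x := d)) = (var_string E)(x := map the_letter d)"
  by (auto simp: dom_odd_def rel_odd_def var_string_def fun_eq_iff)

lemma odd_tuple_update [simp]:
  "odd_tuple padded \<Sigma> w \<tau> k (E(VarT x := d)) = odd_tuple padded \<Sigma> w \<tau> k E"
  by (simp add: odd_tuple_def)

lemma derived_update [simp]: "derived \<tau> (E(VarT x := d)) = derived \<tau> E"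
  by (simp add: derived_def)

text \<open>Domain elements have length at most \<open>k\<close>, so a quantified row of the same
  word reaches the whole domain; membership in the domain is added as a conjunct.\<close>

lemma definable_Exists:
  assumes "definable (\<lambda>k E. odd_tuple padded \<Sigma> w \<tau> k E \<and> sat (derived \<tau> E) (var_string E) \<phi>)"
  shows "definable (\<lambda>k E. odd_tuple padded \<Sigma> w \<tau> k E \<and> sat (derived \<tau> E) (var_string E) (Exists x \<phi>))"
proof (rule definable_cong)
  let ?P = "\<lambda>k E. (odd_tuple padded \<Sigma> w \<tau> k E \<and> sat (derived \<tau> E) (var_string E) \<phi>) \<and>
    1 \<le> k \<and> map the_dom (E DomT) \<in> odds \<Sigma> w k \<and> map the_letter (E (VarT x)) \<in> odd_lang (map the_dom (E DomT))"
  show "definable (\<lambda>k E. \<exists>d. length d \<le> k \<and> ?P k (E(VarT x := d)))"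
    by (rule definable_ex1[of ?P, OF definable_conj[OF assms definable_odd_lang]])
  fix k and E :: "track \<Rightarrow> 'a cell list"
  have domain: "domain (derived \<tau> E) = odd_lang (dom_odd E)"
    by (simp add: derived_def derived_structure_def)
  show "(\<exists>d. length d \<le> k \<and> ?P k (E(VarT x := d))) \<longleftrightarrow>
    odd_tuple padded \<Sigma> w \<tau> k E \<and> sat (derived \<tau> E) (var_string E) (Exists x \<phi>)" (is "?l \<longleftrightarrow> ?r")
  proof
    assume ?l
    then show ?r
      by (auto simp: domain dom_odd_def)
  next
    assume r: ?r
    then obtain s where s: "s \<in> odd_lang (dom_odd E)" "sat (derived \<tau> E) ((var_string E)(x := s)) \<phi>"
      by (auto simp: domain)
    have D: "1 \<le> k" "dom_odd E \<in> odds \<Sigma> w k"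
      using r by (auto simp: odd_tuple_def)
    show ?l
      using r s D length_odd_lang[OF s(1) D(2)]
      by (intro exI[of _ "map VarC s"]) (simp add: comp_def dom_odd_def)
  qed
qed

text \<open>The auxiliary row holds the tensor of the arguments, whose acceptance bounds its length
  by \<open>k\<close>. Nonemptiness of the arguments, part of \<open>rel_of_lang\<close>, is checked
  row by row.\<close>

lemma definable_Rel:
  assumes i: "i < length \<tau>" "length xs = \<tau> ! i" and ne: "xs \<noteq> []"
  shows "definable (\<lambda>k E. odd_tuple padded \<Sigma> w \<tau> k E \<and> sat (derived \<tau> E) (var_string E) (Rel i xs))"
proof (rule definable_cong)
  let ?\<Gamma> = "tensor_alphabet padded (replicate (\<tau> ! i) \<Sigma>)"
  let ?P = "\<lambda>k E. map the_col (E AuxT) = tensor (map (\<lambda>j. map the_letter (E (VarT j))) xs) \<and>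
    1 \<le> k \<and> map the_rel (E (RelT i)) \<in> odds ?\<Gamma> w k \<and>
    map the_col (E AuxT) \<in> odd_lang (map the_rel (E (RelT i)))"
  show "definable (\<lambda>k E. odd_tuple padded \<Sigma> w \<tau> k E \<and>
    (\<forall>j\<in>set xs. \<not> (\<forall>p<k. sym_at (E (VarT j)) p = None)) \<and>
    (\<exists>d. length d \<le> k \<and> ?P k (E(AuxT := d))))"
    by (intro definable_ex1[of ?P] definable_conj definable_odd_tuple definable_Ball_finite
        definable_not definable_pointwise definable_tensor ne definable_odd_lang) simp
  fix k and E :: "track \<Rightarrow> 'a cell list"
  assume E: "\<forall>t. length (E t) \<le> k"
  let ?s = "tensor (map (var_string E) xs)"
  have "(\<forall>j\<in>set xs. \<not> (\<forall>p<k. sym_at (E (VarT j)) p = None)) \<longleftrightarrow> [] \<notin> set (map (var_string E) xs)"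
    if "1 \<le> k"
  proof -
    have "(\<forall>p<k. sym_at (E (VarT j)) p = None) \<longleftrightarrow> [] = var_string E j" for j
      using E[rule_format, of "VarT j"] that by (auto simp: var_string_def sym_at_eq_None_iff)
    then show ?thesis
      by auto
  qed
  moreover have "(\<exists>d. length d \<le> k \<and> ?P k (E(AuxT := d))) \<longleftrightarrow> ?s \<in> odd_lang (rel_odd E i)" (is "?l \<longleftrightarrow> ?r")
    if ok: "odd_tuple padded \<Sigma> w \<tau> k E"
  proof
    assume ?l
    then show ?r
      by (auto simp: var_string_def[abs_def] rel_odd_def)
  next
    assume r: ?r
    have D: "1 \<le> k" "rel_odd E i \<in> odds ?\<Gamma> w k"
      using ok i by (auto simp: odd_tuple_def)
    show ?l
      using D r length_odd_lang[OF r D(2)]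
      by (intro exI[of _ "map ColC ?s"]) (simp add: comp_def var_string_def[abs_def] rel_odd_def)
  qed
  moreover have "sat (derived \<tau> E) (var_string E) (Rel i xs) \<longleftrightarrow>
    [] \<notin> set (map (var_string E) xs) \<and> ?s \<in> odd_lang (rel_odd E i)"
    using i by (simp add: derived_def derived_structure_def rel_of_lang_def)
  moreover have "1 \<le> k" if "odd_tuple padded \<Sigma> w \<tau> k E"
    using that by (simp add: odd_tuple_def)
  ultimately show "(odd_tuple padded \<Sigma> w \<tau> k E \<and>
    (\<forall>j\<in>set xs. \<not> (\<forall>p<k. sym_at (E (VarT j)) p = None)) \<and>
    (\<exists>d. length d \<le> k \<and> ?P k (E(AuxT := d)))) \<longleftrightarrow>
    odd_tuple padded \<Sigma> w \<tau> k E \<and> sat (derived \<tau> E) (var_string E) (Rel i xs)"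
    by meson
qed

text \<open>Complementation relative to \<open>odd_tuple\<close>, which is conjoined again after
  negating.\<close>

lemma definable_sat_Neg:
  assumes "definable (\<lambda>k E. odd_tuple padded \<Sigma> w \<tau> k E \<and> sat (derived \<tau> E) (var_string E) \<phi>)"
  shows "definable (\<lambda>k E. odd_tuple padded \<Sigma> w \<tau> k E \<and> sat (derived \<tau> E) (var_string E) (Neg \<phi>))"
  by (rule definable_cong[OF definable_conj[OF definable_odd_tuple definable_not[OF assms]]]) auto

lemma definable_sat:
  assumes "\<forall>a\<in>set \<tau>. 1 \<le> a" and "formula_over \<tau> \<phi>"
  shows "definable (\<lambda>k E. odd_tuple padded \<Sigma> w \<tau> k E \<and> sat (derived \<tau> E) (var_string E) \<phi>)"
  using assms(2)
proof (induction \<phi>)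
  case (Eq x y)
  have "definable (\<lambda>k E. odd_tuple padded \<Sigma> w \<tau> k E \<and>
    map the_letter (E (VarT x)) = map the_letter (E (VarT y)))"
    by (intro definable_conj definable_odd_tuple definable_eq)
  then show ?case
    by (simp add: var_string_def)
next
  case (Rel i xs)
  then have "1 \<le> length xs"
    using assms(1) by simp
  then show ?case
    using Rel by (intro definable_Rel) auto
next
  case (Neg \<phi>)
  then have "definable (\<lambda>k E. odd_tuple padded \<Sigma> w \<tau> k E \<and> sat (derived \<tau> E) (var_string E) \<phi>)"
    by simp
  then show ?case
    by (rule definable_sat_Neg)
next
  case (Conj \<phi> \<psi>)
  then have "definable (\<lambda>k E. odd_tuple padded \<Sigma> w \<tau> k E \<and> sat (derived \<tau> E) (var_string E) \<phi>)"
    "definable (\<lambda>k E. odd_tuple padded \<Sigma> w \<tau> k E \<and> sat (derived \<tau> E) (var_string E) \<psi>)"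
    by simp_all
  from definable_conj[OF this] show ?case
    by (rule definable_cong) auto
next
  case (Disj \<phi> \<psi>)
  then have "definable (\<lambda>k E. odd_tuple padded \<Sigma> w \<tau> k E \<and> sat (derived \<tau> E) (var_string E) \<phi>)"
    "definable (\<lambda>k E. odd_tuple padded \<Sigma> w \<tau> k E \<and> sat (derived \<tau> E) (var_string E) \<psi>)"
    by simp_all
  \<comment> \<open>De Morgan: negating each conjunction and then the whole restores
    \<open>odd_tuple\<close> by itself.\<close>
  from definable_not[OF definable_conj[OF this[THEN definable_not]]] show ?case
    by (rule definable_cong) auto
next
  case (Exists x \<phi>)
  then show ?case
    by (intro definable_Exists) simp
next
  case (Forall x \<phi>)
  then have "definable (\<lambda>k E. odd_tuple padded \<Sigma> w \<tau> k E \<and> sat (derived \<tau> E) (var_string E) \<phi>)"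
    by simp
  then have "definable (\<lambda>k E. odd_tuple padded \<Sigma> w \<tau> k E \<and>
    sat (derived \<tau> E) (var_string E) (Neg (Exists x (Neg \<phi>))))"
    by (intro definable_sat_Neg definable_Exists)
  then show ?case
    by simp
qed

section \<open>The relation of satisfying tuples\<close>

lemma finite_with_pad: "finite \<Gamma> \<Longrightarrow> finite (with_pad \<Gamma>)"
  by (simp add: with_pad_def)

lemma finite_listset:
  assumes "\<forall>S\<in>set Ss. finite S"
  shows "finite (listset Ss)"
  using assms
proof (induction Ss)
  case (Cons S Ss)
  have "set_Cons S (listset Ss) = (\<lambda>(x, xs). x # xs) ` (S \<times> listset Ss)"
    by (auto simp: set_Cons_def)
  then show ?case
    using Cons by simp
qed simp

lemma finite_tensor_alphabet:
  "\<forall>\<Gamma>\<in>set \<Gamma>s. finite \<Gamma> \<Longrightarrow> finite (tensor_alphabet padded \<Gamma>s)"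
  unfolding tensor_alphabet_def by (intro finite_listset) (auto simp: finite_with_pad)

lemma finite_layers:
  assumes "finite \<Gamma>"
  shows "finite (layers \<Gamma> w)"
proof (rule finite_subset)
  let ?W = "Pow {..<w}"
  let ?mk = "\<lambda>(l, r, T, I, F, i, f). \<lparr>lft = l, rgt = r, edges = T, init = I, final = F, is_first = i, is_last = f\<rparr>"
  show "layers \<Gamma> w \<subseteq> ?mk ` (?W \<times> ?W \<times> Pow ({..<w} \<times> with_pad \<Gamma> \<times> {..<w}) \<times> ?W \<times> ?W \<times> UNIV \<times> UNIV)"
  proof
    fix B
    assume B: "B \<in> layers \<Gamma> w"
    have "edges B \<subseteq> lft B \<times> with_pad \<Gamma> \<times> rgt B" "lft B \<subseteq> {..<w}" "rgt B \<subseteq> {..<w}"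
      "init B \<subseteq> lft B" "final B \<subseteq> rgt B"
      using B by (simp_all add: layers_def)
    then show "B \<in> ?mk ` (?W \<times> ?W \<times> Pow ({..<w} \<times> with_pad \<Gamma> \<times> {..<w}) \<times> ?W \<times> ?W \<times> UNIV \<times> UNIV)"
      by (intro image_eqI[of _ _ "(lft B, rgt B, edges B, init B, final B, is_first B, is_last B)"]) auto
  qed
  show "finite (?mk ` (?W \<times> ?W \<times> Pow ({..<w} \<times> with_pad \<Gamma> \<times> {..<w}) \<times> ?W \<times> ?W \<times> UNIV \<times> UNIV))"
    using assms by (intro finite_imageI finite_cartesian_product) (auto simp: finite_with_pad)
qed

lemma finite_coord_alphabets:
  assumes "finite \<Sigma>"
  shows "\<forall>\<Gamma>\<in>set (coord_alphabets padded \<Sigma> w \<tau> n). finite \<Gamma>"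
  using assms by (auto simp: coord_alphabets_def intro!: finite_layers finite_tensor_alphabet)

lemma tensor_in_lists_alphabet:
  assumes "us \<in> listset (map nonempty_strings \<Gamma>s)"
  shows "tensor us \<in> lists (tensor_alphabet True \<Gamma>s)"
proof -
  have us: "length us = length \<Gamma>s" "\<And>i. i < length \<Gamma>s \<Longrightarrow> us ! i \<in> nonempty_strings (\<Gamma>s ! i)"
    using assms by (auto simp: in_listset_iff list_all2_conv_all_nth)
  have "sym_at (us ! i) p \<in> with_pad (\<Gamma>s ! i)" if "i < length \<Gamma>s" for i p
    using us(2)[OF that] by (auto simp: nonempty_strings_def sym_at_def with_pad_def in_lists_conv_set)
  then have "map (\<lambda>u. sym_at u p) us \<in> tensor_alphabet True \<Gamma>s" for p
    using us(1) by (simp add: tensor_alphabet_def in_listset_iff list_all2_conv_all_nth)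
  then show ?thesis
    by (auto simp: tensor_def)
qed

lemma map_in_nonempty_strings:
  assumes "s \<in> nonempty_strings \<Gamma>"
  shows "map f s \<in> nonempty_strings (f ` \<Gamma>)"
  using assms by (auto simp: nonempty_strings_def)

lemma odds_nonempty_strings: "D \<in> odds \<Gamma> w k \<Longrightarrow> 1 \<le> k \<Longrightarrow> D \<in> nonempty_strings (layers \<Gamma> w)"
  by (auto simp: odds_def nonempty_strings_def)

lemma sat_relation_subset:
  "sat_relation padded \<Sigma> w \<tau> n \<phi> \<subseteq> listset (map nonempty_strings (coord_alphabets padded \<Sigma> w \<tau> n))"
proof
  fix us
  assume "us \<in> sat_relation padded \<Sigma> w \<tau> n \<phi>"
  then obtain D\<^sub>0 Ds vs where us: "us = map Dom_Layer D\<^sub>0 # map (map Rel_Layer) Ds @ map (map Letter) vs"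
    and struct: "(D\<^sub>0, Ds) \<in> structural_tuples padded \<Sigma> w \<tau>"
    and vs: "length vs = n" "set vs \<subseteq> odd_lang D\<^sub>0"
    by (auto simp: sat_relation_def)
  then obtain k where k: "1 \<le> k" "length Ds = length \<tau>" "D\<^sub>0 \<in> odds \<Sigma> w k"
    "\<And>i. i < length \<tau> \<Longrightarrow> Ds ! i \<in> odds (tensor_alphabet padded (replicate (\<tau> ! i) \<Sigma>)) w k"
    by (auto simp: structural_tuples_def)
  have "map Dom_Layer D\<^sub>0 \<in> nonempty_strings (Dom_Layer ` layers \<Sigma> w)"
    using k by (intro map_in_nonempty_strings odds_nonempty_strings)
  moreover have "list_all2 (\<in>) (map (map Rel_Layer) Ds) (map nonempty_strings
    (map (\<lambda>a. Rel_Layer ` layers (tensor_alphabet padded (replicate a \<Sigma>)) w) \<tau>))"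
    using k by (auto simp: list_all2_conv_all_nth intro!: map_in_nonempty_strings odds_nonempty_strings)
  moreover have "vs ! j \<in> nonempty_strings \<Sigma>" if "j < n" for j
    using vs that odd_lang_subset_strings[OF k(3)] nth_mem by blast
  then have "list_all2 (\<in>) (map (map Letter) vs) (map nonempty_strings (replicate n (Letter ` \<Sigma>)))"
    using vs(1) by (auto simp: list_all2_conv_all_nth intro!: map_in_nonempty_strings)
  ultimately show "us \<in> listset (map nonempty_strings (coord_alphabets padded \<Sigma> w \<tau> n))"
    unfolding in_listset_iff us coord_alphabets_def list.map map_append list_all2_Cons
    by (intro conjI list_all2_appendI)
qed

section \<open>From encoded valuations to tensor products\<close>

definition tuple_of :: "nat \<Rightarrow> nat \<Rightarrow> (track \<Rightarrow> 'a cell list) \<Rightarrow> 'a symbol list list" where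
  "tuple_of m n E = map Dom_Layer (dom_odd E) # map (map Rel_Layer) (map (rel_odd E) [0..<m]) @
     map (map Letter) (map (var_string E) [0..<n])"

text \<open>The effect of \<open>tuple_of\<close> on a single column, in the same order of
  coordinates. As a letter-to-letter map it preserves regularity.\<close>

definition column_of :: "nat \<Rightarrow> nat \<Rightarrow> (track \<Rightarrow> 'a cell option) \<Rightarrow> 'a symbol option list" where
  "column_of m n c = map_option (Dom_Layer \<circ> the_dom) (c DomT) #
     map (\<lambda>i. map_option (Rel_Layer \<circ> the_rel) (c (RelT i))) [0..<m] @
     map (\<lambda>j. map_option (Letter \<circ> the_letter) (c (VarT j))) [0..<n]"

text \<open>The domain row has full length, so the maximum in the tensor is \<open>k\<close> and no
  column is lost.\<close>

lemma tensor_tuple_of: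
  assumes "\<forall>t. length (E t) \<le> k" and "length (E DomT) = k"
  shows "tensor (tuple_of m n E) = map (column_of m n) (enc k E)"
proof -
  have "Max (length ` set (tuple_of m n E)) = k"
    using assms by (intro Max_eqI) (auto simp: tuple_of_def dom_odd_def rel_odd_def var_string_def)
  moreover have "map (\<lambda>u. sym_at u p) (tuple_of m n E) = column_of m n (\<lambda>t. sym_at (E t) p)" for p
    by (simp add: tuple_of_def column_of_def dom_odd_def rel_odd_def var_string_def sym_at_map
        comp_def option.map_comp)
  ultimately show ?thesis
    by (simp add: tensor_def enc_def comp_def)
qed

definition sat_valuation :: "bool \<Rightarrow> 'a set \<Rightarrow> nat \<Rightarrow> nat list \<Rightarrow> nat \<Rightarrow> fo_formula \<Rightarrow> nat \<Rightarrow>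
    (track \<Rightarrow> 'a cell list) \<Rightarrow> bool" where
  "sat_valuation padded \<Sigma> w \<tau> n \<phi> k E \<longleftrightarrow> odd_tuple padded \<Sigma> w \<tau> k E \<and>
     (\<forall>i<length \<tau>. odd_lang (rel_odd E i) \<subseteq> tensor_lang (replicate (\<tau> ! i) (odd_lang (dom_odd E)))) \<and>
     (\<forall>j<n. var_string E j \<in> odd_lang (dom_odd E)) \<and> sat (derived \<tau> E) (var_string E) \<phi>"

lemma definable_sat_valuation:
  assumes "\<forall>a\<in>set \<tau>. 1 \<le> a" and "formula_over \<tau> \<phi>"
  shows "definable (sat_valuation padded \<Sigma> w \<tau> n \<phi>)"
proof (rule definable_cong)
  show "definable (\<lambda>k E. (odd_tuple padded \<Sigma> w \<tau> k E \<and> (\<forall>i<length \<tau>.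
      odd_lang (rel_odd E i) \<subseteq> tensor_lang (replicate (\<tau> ! i) (odd_lang (dom_odd E))))) \<and>
    (\<forall>j\<in>{..<n}. 1 \<le> k \<and> map the_dom (E DomT) \<in> odds \<Sigma> w k \<and>
      map the_letter (E (VarT j)) \<in> odd_lang (map the_dom (E DomT))) \<and>
    (odd_tuple padded \<Sigma> w \<tau> k E \<and> sat (derived \<tau> E) (var_string E) \<phi>))"
    using assms by (intro definable_conj definable_structural definable_Ball_finite
        definable_odd_lang definable_sat) simp_all
qed (auto simp: sat_valuation_def odd_tuple_def dom_odd_def var_string_def)

text \<open>\<open>T\<close> collects the rows that appear in the tuple. Keeping the others empty
  gives finite support, as \<open>regular_definable_image\<close> requires.\<close>

lemma tensor_sat_relation:
  fixes \<tau> :: "nat list"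
  assumes "free_vars \<phi> \<subseteq> {..<n}"
  defines "T \<equiv> insert DomT (RelT ` {..<length \<tau>} \<union> VarT ` {..<n})"
  shows "tensor ` sat_relation padded \<Sigma> w \<tau> n \<phi> = map (column_of (length \<tau>) n) `
    {enc k E | k E. (\<forall>t. length (E t) \<le> k) \<and> (\<forall>t. t \<notin> T \<longrightarrow> E t = []) \<and> sat_valuation padded \<Sigma> w \<tau> n \<phi> k E}"
    (is "?l = ?r")
proof (intro equalityI subsetI)
  fix x
  assume "x \<in> ?l"
  then obtain D\<^sub>0 Ds vs where
    x: "x = tensor (map Dom_Layer D\<^sub>0 # map (map Rel_Layer) Ds @ map (map Letter) vs)"
    and struct: "(D\<^sub>0, Ds) \<in> structural_tuples padded \<Sigma> w \<tau>"
    and vs: "length vs = n" "set vs \<subseteq> odd_lang D\<^sub>0"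
    and sat: "sat (derived_structure \<tau> D\<^sub>0 Ds) (\<lambda>j. vs ! j) \<phi>"
    by (auto simp: sat_relation_def)
  then obtain k where k: "1 \<le> k" "length Ds = length \<tau>" "D\<^sub>0 \<in> odds \<Sigma> w k"
    "\<And>i. i < length \<tau> \<Longrightarrow> Ds ! i \<in> odds (tensor_alphabet padded (replicate (\<tau> ! i) \<Sigma>)) w k"
    "\<And>i. i < length \<tau> \<Longrightarrow> odd_lang (Ds ! i) \<subseteq> tensor_lang (replicate (\<tau> ! i) (odd_lang D\<^sub>0))"
    by (auto simp: structural_tuples_def)
  define E where "E t = (case t of DomT \<Rightarrow> map DomC D\<^sub>0
    | RelT i \<Rightarrow> if i < length \<tau> then map RelC (Ds ! i) else []
    | VarT j \<Rightarrow> if j < n then map VarC (vs ! j) else [] | AuxT \<Rightarrow> [])" for t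
  have E: "dom_odd E = D\<^sub>0" "\<And>i. i < length \<tau> \<Longrightarrow> rel_odd E i = Ds ! i"
    "\<And>j. j < n \<Longrightarrow> var_string E j = vs ! j"
    by (simp_all add: E_def dom_odd_def rel_odd_def var_string_def comp_def)
  have Ds: "map (rel_odd E) [0..<length \<tau>] = Ds"
    using k(2) E(2) by (intro nth_equalityI) auto
  have vs': "map (var_string E) [0..<n] = vs"
    using vs(1) E(3) by (intro nth_equalityI) auto
  have mem: "vs ! j \<in> odd_lang D\<^sub>0" if "j < n" for j
    using vs that by auto
  have lenD: "length D\<^sub>0 = k" "\<And>i. i < length \<tau> \<Longrightarrow> length (Ds ! i) = k"
    using k(3,4) by (auto simp: odds_def)
  have len: "\<forall>t. length (E t) \<le> k" "length (E DomT) = k"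
    using lenD length_odd_lang[OF mem k(3)] by (auto simp: E_def split: track.split)
  \<comment> \<open>From index \<open>n\<close> on, \<open>var_string E\<close> is \<open>[]\<close>
    while \<open>vs ! j\<close> is unspecified; the free variables all lie below
    \<open>n\<close>.\<close>
  have "sat (derived \<tau> E) (var_string E) \<phi> \<longleftrightarrow> sat (derived \<tau> E) (\<lambda>j. vs ! j) \<phi>"
    using assms(1) E(3) by (intro sat_cong_free_vars) auto
  then have "sat (derived \<tau> E) (var_string E) \<phi>"
    using sat by (simp add: derived_def E(1) Ds)
  then have "sat_valuation padded \<Sigma> w \<tau> n \<phi> k E"
    using k mem by (simp add: sat_valuation_def odd_tuple_def E)
  moreover have "\<forall>t. t \<notin> T \<longrightarrow> E t = []"
    by (auto simp: E_def T_def split: track.split)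
  moreover have "x = map (column_of (length \<tau>) n) (enc k E)"
    unfolding tensor_tuple_of[OF len, symmetric] tuple_of_def E(1) Ds vs' x ..
  ultimately show "x \<in> ?r"
    using len(1) by (intro image_eqI[of _ _ "enc k E"] CollectI exI[of _ k] exI[of _ E] conjI) simp_all
next
  fix x
  assume "x \<in> ?r"
  then obtain k E where x: "x = map (column_of (length \<tau>) n) (enc k E)"
    and len: "\<forall>t. length (E t) \<le> k" and E: "sat_valuation padded \<Sigma> w \<tau> n \<phi> k E"
    by blast
  let ?Ds = "map (rel_odd E) [0..<length \<tau>]" and ?vs = "map (var_string E) [0..<n]"
  have "length (E DomT) = k"
    using E by (auto simp: sat_valuation_def odd_tuple_def odds_def dom_odd_def)
  then have "x = tensor (tuple_of (length \<tau>) n E)"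
    using x len by (simp add: tensor_tuple_of)
  moreover have "(dom_odd E, ?Ds) \<in> structural_tuples padded \<Sigma> w \<tau>"
    using E by (auto simp: sat_valuation_def odd_tuple_def structural_tuples_def)
  moreover have "set ?vs \<subseteq> odd_lang (dom_odd E)" "length ?vs = n"
    using E by (auto simp: sat_valuation_def)
  moreover have "sat (derived \<tau> E) (var_string E) \<phi> \<longleftrightarrow> sat (derived \<tau> E) (\<lambda>j. ?vs ! j) \<phi>"
    using assms(1) by (intro sat_cong_free_vars) auto
  then have "sat (derived_structure \<tau> (dom_odd E) ?Ds) (\<lambda>j. ?vs ! j) \<phi>"
    using E by (simp add: sat_valuation_def derived_def)
  ultimately have "x = tensor (tuple_of (length \<tau>) n E)"
    "tuple_of (length \<tau>) n E \<in> sat_relation padded \<Sigma> w \<tau> n \<phi>"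
    unfolding sat_relation_def tuple_of_def
    by (simp, intro CollectI exI[of _ "dom_odd E"] exI[of _ ?Ds] exI[of _ ?vs] conjI refl)
  then show "x \<in> ?l"
    by (rule image_eqI)
qed

theorem theorem4:
  fixes \<Sigma> :: "'a set" and w n :: nat and \<tau> :: "nat list" and \<phi> :: fo_formula and padded :: bool
  assumes "finite \<Sigma>"
    and "w \<ge> 1"
    and "\<forall>a\<in>set \<tau>. a \<ge> 1"
    and "formula_over \<tau> \<phi>"
    and "free_vars \<phi> \<subseteq> {..<n}"
  shows "regular_relation (coord_alphabets padded \<Sigma> w \<tau> n) (sat_relation padded \<Sigma> w \<tau> n \<phi>)"
proof -
  \<comment> \<open>The tensors form a letterwise image of the encodings of a definable set of
    valuations supported on finitely many rows.\<close>
  have "regular (tensor ` sat_relation padded \<Sigma> w \<tau> n \<phi>)"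
    unfolding tensor_sat_relation[OF assms(5)] using assms(3,4)
    by (intro regular_map_image regular_definable_image definable_sat_valuation) simp_all
  moreover have "finite (tensor_alphabet True (coord_alphabets padded \<Sigma> w \<tau> n))"
    using assms(1) by (intro finite_tensor_alphabet finite_coord_alphabets)
  moreover have "tensor ` sat_relation padded \<Sigma> w \<tau> n \<phi> \<subseteq>
      lists (tensor_alphabet True (coord_alphabets padded \<Sigma> w \<tau> n))"
    by (intro image_subsetI tensor_in_lists_alphabet subsetD[OF sat_relation_subset])
  ultimately show ?thesis
    unfolding regular_relation_def by (intro conjI sat_relation_subset regular_imp_nfa)
qed

end
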